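(* Let $P$ be a primitive necklace of length $|P|\ge 3$. There is a power series $H_P(x)\in\mathbb{Z}[[x]]$ such that the sequence of generating functions $(\mathcal{D}_{P^k}(x))_{k\ge 1}$ converges to $H_P(x)$ coefficient-wise. Moreover, $H_P(x)$ is a rational function having denominator polynomial of degree at most $|P|$ and numerator polynomial of degree at most $2|P|$.
   Context: For a positive integer $n$, the Bulgarian Solitaire map $\beta$ acts on the set $\mathcal{P}(n)$ of integer partitions of $n$: given $\lambda=(\lambda_1\ge\dots\ge\lambda_\ell>0)$, subtract $1$ from each of the $\ell$ parts, add a new part equal to $\ell$, discard zero parts, and sort into weakly decreasing order. The orbits of $\beta$ are the weakly connected components of the directed graph on $\mathcal{P}(n)$ with edges $\lambda\to\beta(\lambda)$; each contains a unique recurrent cycle, consisting of those $\lambda$ with $\beta^m(\lambda)=\lambda$ for some $m\ge 1$. A necklace is an equivalence class of finite words in the letters $\{B,W\}$ under cyclic rotation; its length $|N|$ is the number of letters. A $0/1$-vector encodes a necklace $N$ if replacing $1$ by $B$ and $0$ by $W$ gives a word in the class $N$. $P^k$ denotes the concatenation of $k$ copies of $P$. A necklace is primitive if it is not of the form $Q^k$ with $k\ge 2$ for another necklace $Q$. By a theorem of Brandt, to each necklace $N$ of length $m$ corresponds an orbit $\mathcal{O}_N$ of $\beta$ on $\mathcal{P}(n)$, where $n=\binom{m}{2}+\#\{\text{black beads of }N\}$: its recurrent cycle $C_N$ consists of exactly the partitions $\lambda$ (padded with zeros to length $m$) for which $\lambda-(m-1,m-2,\dots,1,0)$ is a $0/1$-vector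 encoding $N$. Thus $\mathcal{O}_N$ is the set of all partitions of $n$ that eventually enter $C_N$ under iteration of $\beta$. For $\lambda\in\mathcal{O}_N$ let $\mathrm{level}(\lambda)=\min\{m\in\{0,1,2,\dots\}:\beta^m(\lambda)\in C_N\}$, and let $\mathcal{D}_N(x)=\sum_{\lambda\in\mathcal{O}_N}x^{\mathrm{level}(\lambda)}\in\mathbb{Z}[x]$. *)

theory Defs
  imports "HOL-Computational_Algebra.Computational_Algebra"
begin

definition partitions :: "nat \<Rightarrow> nat list set" where
  "partitions n = {xs. sorted_wrt (\<ge>) xs \<and> (\<forall>x\<in>set xs. 0 < x) \<and> sum_list xs = n}"

lemma finite_partitions: "finite (partitions n)"
proof (rule finite_subset)
  show "partitions n \<subseteq> {xs. set xs \<subseteq> {..n} \<and> length xs \<le> n}"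
  proof
    fix xs assume xs: "xs \<in> partitions n"
    have "length xs \<le> sum_list xs" if "\<forall>x\<in>set xs. 0 < x" for xs :: "nat list"
      using that by (induction xs) auto
    with xs show "xs \<in> {xs. set xs \<subseteq> {..n} \<and> length xs \<le> n}"
      by (auto simp: partitions_def dest: member_le_sum_list)
  qed
  show "finite {xs. set xs \<subseteq> {..n} \<and> length xs \<le> n}"
    by (rule finite_lists_length_le) simp
qed

definition bulgarian :: "nat list \<Rightarrow> nat list" where
  "bulgarian xs = rev (sort (filter (\<lambda>x. 0 < x) (length xs # map (\<lambda>x. x - 1) xs)))"

lemma bulgarian_partitions:
  assumes "xs \<in> partitions n"
  shows "bulgarian xs \<in> partitions n"
proof -
  have 1: "sorted_wrt (\<ge>) (bulgarian xs)"
    by (simp add: bulgarian_def sorted_wrt_rev)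
  have filt: "sum_list (filter (\<lambda>x. 0 < x) ys) = sum_list ys" for ys :: "nat list"
    by (induction ys) auto
  have dec: "length ys + sum_list (map (\<lambda>x. x - 1) ys) = sum_list ys"
    if "\<forall>y\<in>set ys. 0 < y" for ys :: "nat list"
    using that by (induction ys) auto
  have srt: "sum_list (sort ys) = sum_list ys" for ys :: "nat list"
    by (metis mset_sort sum_mset_sum_list)
  have "sum_list (bulgarian xs) = length xs + sum_list (map (\<lambda>x. x - 1) xs)"
    unfolding bulgarian_def sum_list_rev srt filt by simp
  also have "\<dots> = n"
    using assms dec by (auto simp: partitions_def)
  finally show ?thesis
    using 1 by (auto simp: partitions_def bulgarian_def)
qed

datatype bead = Black | White

definition rotation_equiv :: "bead list \<Rightarrow> bead list \<Rightarrow> bool" where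
  "rotation_equiv u v \<longleftrightarrow> (\<exists>k. v = rotate k u)"

quotient_type necklace = "bead list" / rotation_equiv
proof (rule equivpI)
  show "reflp rotation_equiv"
    by (rule reflpI) (metis rotation_equiv_def rotate0 id_apply)
  show "symp rotation_equiv"
  proof (rule sympI)
    fix u v assume "rotation_equiv u v"
    then obtain k where v: "v = rotate k u"
      by (auto simp: rotation_equiv_def)
    have "rotate (length u - k mod length u) v = u"
    proof (cases "u = []")
      case False
      then have "k mod length u < length u"
        by simp
      moreover have "v = rotate (k mod length u) u"
        unfolding v by (rule rotate_conv_mod)
      ultimately show ?thesis
        by (simp add: rotate_rotate)
    qed (simp add: v)
    then show "rotation_equiv v u"
      by (metis rotation_equiv_def)
  qed
  show "transp rotation_equiv"
    by (rule transpI) (auto simp: rotation_equiv_def rotate_rotate)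
qed

lift_definition necklace_of :: "bead list \<Rightarrow> necklace" is "\<lambda>w. w" .

lift_definition necklace_length :: "necklace \<Rightarrow> nat" is length
  by (auto simp: rotation_equiv_def)

lift_definition black_beads :: "necklace \<Rightarrow> nat" is "\<lambda>w. count_list w Black"
proof -
  fix u v assume "rotation_equiv u v"
  then obtain k where "v = rotate k u"
    by (auto simp: rotation_equiv_def)
  then have "mset v = mset u"
    by (metis append_take_drop_id mset_append rotate_drop_take union_commute)
  then show "count_list u Black = count_list v Black"
    by (metis count_mset)
qed

lemma rotation_equiv_replicate:
  assumes "rotation_equiv u v"
  shows "rotation_equiv (concat (replicate k u)) (concat (replicate k v))"
proof -
  have step: "rotate1 (concat (replicate k w)) = concat (replicate k (rotate1 w))" for w :: "bead list"
  proof (cases w)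
    case (Cons a w')
    have shift: "concat (replicate m (a # w')) @ [a] = a # concat (replicate m (w' @ [a]))" for m
      by (induction m) auto
    show ?thesis
      using Cons shift by (cases k) auto
  qed (cases k; simp)
  have "rotate j (concat (replicate k u)) = concat (replicate k (rotate j u))" for j
    by (induction j) (simp_all add: step)
  with assms show ?thesis
    by (auto simp: rotation_equiv_def)
qed

lift_definition necklace_power :: "necklace \<Rightarrow> nat \<Rightarrow> necklace"
  is "\<lambda>w k. concat (replicate k w)"
  by (rule rotation_equiv_replicate)

definition primitive :: "necklace \<Rightarrow> bool" where
  "primitive N \<longleftrightarrow> \<not> (\<exists>Q k. 2 \<le> k \<and> N = necklace_power Q k)"

definition encodes :: "int list \<Rightarrow> necklace \<Rightarrow> bool" where
  "encodes v N \<longleftrightarrow> set v \<subseteq> {0, 1} \<and>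
     necklace_of (map (\<lambda>x. if x = 1 then Black else White) v) = N"

definition pad :: "nat \<Rightarrow> nat list \<Rightarrow> nat list" where
  "pad m xs = xs @ replicate (m - length xs) 0"

definition staircase_diff :: "nat \<Rightarrow> nat list \<Rightarrow> int list" where
  "staircase_diff m xs = map2 (\<lambda>a b. int a - int b) (pad m xs) (rev [0..<m])"

definition orbit_weight :: "necklace \<Rightarrow> nat" where
  "orbit_weight N = (necklace_length N choose 2) + black_beads N"

text \<open>\<open>pad m xs\<close> is only meaningful if \<open>xs\<close> has at most \<open>m\<close> parts, and \<open>map2\<close> in
  \<open>staircase_diff\<close> truncates silently otherwise; hence the explicit bound on the number of
  parts below.\<close>

definition recurrent_cycle :: "necklace \<Rightarrow> nat list set" where
  "recurrent_cycle N = {xs \<in> partitions (orbit_weight N).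
     length xs \<le> necklace_length N \<and> encodes (staircase_diff (necklace_length N) xs) N}"

text \<open>By Brandt's theorem \<open>recurrent_cycle N\<close> is a cycle of the functional graph of
  \<open>bulgarian\<close>, so its weakly connected component consists of all partitions that eventually
  enter it.\<close>

definition orbit :: "necklace \<Rightarrow> nat list set" where
  "orbit N = {xs \<in> partitions (orbit_weight N). \<exists>m. (bulgarian ^^ m) xs \<in> recurrent_cycle N}"

text \<open>Meaningful for \<open>xs \<in> orbit N\<close> only.\<close>

definition level :: "necklace \<Rightarrow> nat list \<Rightarrow> nat" where
  "level N xs = (LEAST m. (bulgarian ^^ m) xs \<in> recurrent_cycle N)"

definition level_poly :: "necklace \<Rightarrow> int poly" where
  "level_poly N = (\<Sum>xs\<in>orbit N. monom 1 (level N xs))"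

lemma finite_orbit: "finite (orbit N)"
  by (rule finite_subset[OF _ finite_partitions]) (auto simp: orbit_def)

end

theory Submission
  imports Defs
begin

text \<open>
  Why the limit exists. Play backwards: a predecessor of \<open>\<lambda>\<close> is obtained by choosing a part \<open>c\<close> of \<open>\<lambda>\<close>
  that is at least the number of parts minus \<open>1\<close>, deleting it, adding \<open>1\<close> to all other parts, and padding
  with ones up to \<open>c\<close> parts. Apart from the deletion, the large parts only undergo a common
  translation. In moving coordinates they stand still, and a sequence of backward moves is just a
  walk that consumes elements of a fixed multiset of integers; the condition on \<open>c\<close> becomes a
  bound of \<open>2\<close> on the steps in one direction (\<open>card_backward_plays\<close>). Starting in the cycle of
  \<open>P\<^sup>k\<close>, the multiset is \<open>j - v\<^sub>j\<close> for the periodic \<open>0/1\<close> sequence \<open>v\<close>, and \<open>i\<close> moves see only a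
  bounded initial piece of it. Hence the counts do not depend on \<open>k\<close> once \<open>k\<close> is large compared
  with \<open>i\<close>. Since a cycle is closed under the Solitaire map, the number of partitions of level \<open>i\<close> is
  the difference of the numbers of walks of lengths \<open>i\<close> and \<open>i - 1\<close> (\<open>coeff_level_poly_power\<close>).

  Why the limit is rational. A primitive necklace of length \<open>p \<ge> 3\<close> contains a black bead
  followed by a white one such that the bead before is black or the bead after is white
  (\<open>primitive_has_bottleneck\<close>). Such a pair leaves one integer \<open>g\<close> unoccupied, while one of its
  neighbours is occupied only once. A walk can pass \<open>g\<close> only by stepping from one neighbour to the
  other, so it passes at most once (\<open>walks_split_at_gap\<close>). Therefore a passing walk consists of a
  piece before \<open>g\<close>, a walk beyond \<open>g\<close>, and possibly a final piece in what was left over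
  before \<open>g\<close>; the part beyond is independent of the two others. If \<open>L\<close> counts the walks in one
  period that never pass and \<open>C\<close> the pairs of outer pieces, then the series \<open>K\<close> of nonempty walks
  beyond a bottleneck satisfies \<open>K + 1 = L + C K\<close>, that is \<open>K = (L - 1) / (1 - C)\<close>
  (\<open>walk_gf_rational\<close>). A period has \<open>p\<close> elements, so \<open>L\<close> and \<open>C\<close> have degree at most \<open>p\<close>. A walk that starts
  in the middle of a period contributes \<open>L' + C' K\<close> with \<open>L'\<close> and \<open>C'\<close> of degree at most \<open>p - 1\<close>; together with the
  factor \<open>1 - x\<close> from taking differences, the numerator has degree at most \<open>1 + (p - 1) + p = 2 p\<close>.
\<close>

section \<open>Walks on a multiset of integers\<close>

text \<open>A backward play, seen in coordinates in which the untouched parts stand still: the letters are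
  the negated parts that are taken away one after the other, \<open>f x\<close> is the number of parts available
  at \<open>x\<close>, and \<open>e\<close> stands for the part taken last before the play. A step may go down
  arbitrarily far, but up by at most \<open>2\<close>.\<close>

definition walks :: "int \<Rightarrow> (int \<Rightarrow> nat) \<Rightarrow> int list set" where
  "walks e f = {ws. successively (\<lambda>a b. b \<le> a + 2) (e # ws) \<and> (\<forall>x. count_list ws x \<le> f x)}"

lemma walk_le:
  assumes "successively (\<lambda>a b. b \<le> a + 2) (e # ws)" "x \<in> set ws"
  shows "x \<le> e + 2 * int (length ws)"
  using assms
proof (induction ws arbitrary: e)
  case (Cons w ws)
  show ?case
  proof (cases "x = w")
    case False
    with Cons have "x \<le> w + 2 * int (length ws)" by simp
    moreover have "w \<le> e + 2" using Cons.prems by simp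
    ultimately show ?thesis by simp
  qed (use Cons.prems in auto)
qed simp

lemma walk_site:
  assumes "ws \<in> walks e f" "x \<in> set ws"
  shows "0 < f x"
proof -
  have "count_list ws x \<le> f x" using assms by (simp add: walks_def)
  moreover have "count_list ws x \<noteq> 0" using assms(2) by (simp add: count_list_0_iff)
  ultimately show ?thesis by simp
qed

lemma finite_walks:
  assumes "\<And>x. x < lo \<Longrightarrow> f x = 0"
  shows "finite {ws \<in> walks e f. length ws = n}"
proof (rule finite_subset)
  show "{ws \<in> walks e f. length ws = n} \<subseteq> {ws. set ws \<subseteq> {lo..e + 2 * int n} \<and> length ws = n}"
  proof safe
    fix ws x assume ws: "ws \<in> walks e f" "x \<in> set ws" "n = length ws"
    from walk_site[OF ws(1,2)] assms have "lo \<le> x" by (metis less_irrefl not_le)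
    with ws walk_le[of e ws x] show "x \<in> {lo..e + 2 * int (length ws)}" by (auto simp: walks_def)
  qed
qed (rule finite_lists_length_eq, simp)

text \<open>A walk rises by at most \<open>2\<close> per step, so walks of bounded length are blind to high sites. This
  is what makes level counts stabilise.\<close>

lemma walks_cong:
  assumes "\<And>x. x \<le> e + 2 * int n \<Longrightarrow> f x = f' x"
  shows "{ws \<in> walks e f. length ws = n} = {ws \<in> walks e f'. length ws = n}"
proof -
  have "(\<forall>x. count_list ws x \<le> f x) \<longleftrightarrow> (\<forall>x. count_list ws x \<le> f' x)"
    if "successively (\<lambda>a b. b \<le> a + 2) (e # ws)" "length ws = n" for ws
  proof (rule iff_allI)
    fix x
    show "count_list ws x \<le> f x \<longleftrightarrow> count_list ws x \<le> f' x"
    proof (cases "x \<in> set ws")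
      case True
      with walk_le[OF that(1)] that(2) assms show ?thesis by auto
    qed (simp add: count_notin)
  qed
  then show ?thesis unfolding walks_def by blast
qed

lemma card_walks_shift:
  "card {ws \<in> walks (e + d) f. length ws = n} =
   card {ws \<in> walks e (\<lambda>x. f (x + d)). length ws = n}"
proof -
  have inj: "inj (\<lambda>x::int. x + d)" by (simp add: inj_def)
  have cnt: "count_list (map (\<lambda>x. x + d) ws) (y + d) = count_list ws y" for ws y
    by (induction ws) auto
  have "bij_betw (map (\<lambda>x. x + d)) {ws \<in> walks e (\<lambda>x. f (x + d)). length ws = n}
    {ws \<in> walks (e + d) f. length ws = n}"
  proof (rule bij_betw_byWitness[where f' = "map (\<lambda>x. x - d)"])
    show "map (\<lambda>x. x + d) ` {ws \<in> walks e (\<lambda>x. f (x + d)). length ws = n}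
      \<subseteq> {ws \<in> walks (e + d) f. length ws = n}"
    proof safe
      fix ws assume ws: "ws \<in> walks e (\<lambda>x. f (x + d))"
      have "count_list (map (\<lambda>x. x + d) ws) x \<le> f x" for x
        using ws cnt[of ws "x - d"] by (auto simp: walks_def dest: spec[of _ "x - d"])
      moreover have "successively (\<lambda>a b. b \<le> a + 2) (map (\<lambda>x. x + d) (e # ws))"
        using ws unfolding successively_map by (simp add: walks_def)
      ultimately show "map (\<lambda>x. x + d) ws \<in> walks (e + d) f" by (simp add: walks_def)
    qed simp
    show "map (\<lambda>x. x - d) ` {ws \<in> walks (e + d) f. length ws = n}
      \<subseteq> {ws \<in> walks e (\<lambda>x. f (x + d)). length ws = n}"
    proof safe
      fix ws assume ws: "ws \<in> walks (e + d) f"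
      have "count_list (map (\<lambda>x. x - d) ws) x \<le> f (x + d)" for x
        using ws cnt[of "map (\<lambda>x. x - d) ws" x, symmetric] by (simp add: walks_def o_def)
      moreover have "successively (\<lambda>a b. b \<le> a + 2) (map (\<lambda>x. x - d) ((e + d) # ws))"
        using ws unfolding successively_map by (simp add: walks_def)
      ultimately show "map (\<lambda>x. x - d) ws \<in> walks e (\<lambda>x. f (x + d))" by (simp add: walks_def)
    qed simp
  qed (auto simp: o_def)
  from bij_betw_same_card[OF this] show ?thesis by simp
qed

lemma card_walks_Suc:
  assumes lo: "\<And>x. x < lo \<Longrightarrow> f x = 0"
  shows "card {ws \<in> walks e f. length ws = Suc n} =
    (\<Sum>w | w \<le> e + 2 \<and> 0 < f w. card {ws \<in> walks w (f(w := f w - 1)). length ws = n})"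
    (is "_ = (\<Sum>w\<in>?I. card (?W w))")
proof -
  have mem: "w # ws \<in> walks e f \<longleftrightarrow> w \<in> ?I \<and> ws \<in> walks w (f(w := f w - 1))" for w ws
  proof -
    have "(\<forall>x. count_list (w # ws) x \<le> f x) \<longleftrightarrow>
      0 < f w \<and> (\<forall>x. count_list ws x \<le> (f(w := f w - 1)) x)" (is "?A \<longleftrightarrow> ?B")
    proof
      assume A: ?A
      from spec[OF A, of w] have "0 < f w" by simp
      moreover have "count_list ws x \<le> (f(w := f w - 1)) x" for x
        using spec[OF A, of x] by (auto split: if_splits)
      ultimately show ?B by blast
    next
      assume B: ?B
      show ?A
      proof
        fix x show "count_list (w # ws) x \<le> f x"
          using B by (cases "x = w") (auto dest: spec[of _ x])
      qed
    qed
    then show ?thesis by (auto simp: walks_def)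
  qed
  have "{ws \<in> walks e f. length ws = Suc n} = (\<Union>w\<in>?I. (#) w ` ?W w)"
    by (auto simp: length_Suc_conv mem)
  also have "card \<dots> = (\<Sum>w\<in>?I. card ((#) w ` ?W w))"
  proof (rule card_UN_disjoint)
    have "?I \<subseteq> {lo..e + 2}" using lo by (auto simp: not_less[symmetric])
    then show "finite ?I" by (rule finite_subset) simp
    have "finite (?W w)" for w
      by (rule finite_walks[of lo]) (use lo in auto)
    then show "\<forall>w\<in>?I. finite ((#) w ` ?W w)" by blast
  qed auto
  also have "\<dots> = (\<Sum>w\<in>?I. card (?W w))" by (simp add: card_image)
  finally show ?thesis .
qed

section \<open>Generating functions of sets with a size\<close>

definition ogf :: "('a \<Rightarrow> nat) \<Rightarrow> 'a set \<Rightarrow> int fps" where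
  "ogf sz S = Abs_fps (\<lambda>n. int (card {s \<in> S. sz s = n}))"

lemma ogf_Un_disjoint:
  assumes "\<And>n. finite {s \<in> S. sz s = n}" "\<And>n. finite {s \<in> T. sz s = n}" "S \<inter> T = {}"
  shows "ogf sz (S \<union> T) = ogf sz S + ogf sz T"
proof (rule fps_ext)
  fix n
  have "{s \<in> S \<union> T. sz s = n} = {s \<in> S. sz s = n} \<union> {s \<in> T. sz s = n}" by auto
  moreover have "card \<dots> = card {s \<in> S. sz s = n} + card {s \<in> T. sz s = n}"
    by (rule card_Un_disjoint) (use assms in auto)
  ultimately show "fps_nth (ogf sz (S \<union> T)) n = fps_nth (ogf sz S + ogf sz T) n"
    by (simp add: ogf_def)
qed

lemma ogf_Times:
  assumes "\<And>n. finite {s \<in> S. sz s = n}" "\<And>n. finite {t \<in> T. sz' t = n}"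
  shows "ogf (\<lambda>(s, t). sz s + sz' t) (S \<times> T) = ogf sz S * ogf sz' T"
proof (rule fps_ext)
  fix n
  have "{x \<in> S \<times> T. (case x of (s, t) \<Rightarrow> sz s + sz' t) = n} =
    (\<Union>i\<in>{0..n}. {s \<in> S. sz s = i} \<times> {t \<in> T. sz' t = n - i})" by auto
  also have "card \<dots> = (\<Sum>i=0..n. card ({s \<in> S. sz s = i} \<times> {t \<in> T. sz' t = n - i}))"
    by (rule card_UN_disjoint) (use assms in auto)
  finally show "fps_nth (ogf (\<lambda>(s, t). sz s + sz' t) (S \<times> T)) n = fps_nth (ogf sz S * ogf sz' T) n"
    by (simp add: ogf_def fps_mult_nth card_cartesian_product)
qed

lemma ogf_bij_betw:
  assumes "bij_betw h S T" "\<And>s. s \<in> S \<Longrightarrow> sz' (h s) = sz s"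
  shows "ogf sz S = ogf sz' T"
proof (rule fps_ext)
  fix n
  have "bij_betw h {s \<in> S. sz s = n} {t \<in> T. sz' t = n}"
    using assms unfolding bij_betw_def by (auto simp: inj_on_def)
  then show "fps_nth (ogf sz S) n = fps_nth (ogf sz' T) n"
    by (simp add: ogf_def bij_betw_same_card)
qed

lemma fps_eq_poly_of_bounded:
  fixes F :: "int fps"
  assumes "\<And>n. n > d \<Longrightarrow> fps_nth F n = 0"
  shows "\<exists>p. F = fps_of_poly p \<and> degree p \<le> d"
proof (intro exI conjI)
  let ?p = "\<Sum>i\<le>d. monom (fps_nth F i) i"
  show "F = fps_of_poly ?p"
    using assms by (intro fps_ext) (simp add: coeff_sum sum.delta' not_le)
  show "degree ?p \<le> d"
    by (intro degree_sum_le) (auto intro: order_trans[OF degree_monom_le])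
qed

section \<open>Walks across an empty site\<close>

text \<open>An empty site \<open>g\<close> can only be passed upwards by the single step from \<open>g - 1\<close> to \<open>g + 1\<close>.\<close>

lemma walk_crossing:
  fixes e g x :: int
  assumes "successively (\<lambda>a b. b \<le> a + 2) (e # ws)" "e < g" "g \<notin> set ws" "x \<in> set ws" "g < x"
  shows "g - 1 \<in> set (e # ws) \<and> g + 1 \<in> set ws"
  using assms
proof (induction ws arbitrary: e)
  case (Cons w ws)
  show ?case
  proof (cases "w < g")
    case True
    with Cons.prems have "x \<in> set ws" by auto
    with Cons True show ?thesis by auto
  qed (use Cons.prems in auto)
qed simp

text \<open>What a walk that passes the empty site \<open>g\<close> does below \<open>g\<close>: it arrives at \<open>g - 1\<close> along \<open>us\<close>,
  and after its stay above \<open>g\<close> it may come back and continue with \<open>vs\<close>. The first letter of \<open>vs\<close> is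
  unconstrained since steps down are free; the two words compete for the same sites.\<close>

definition crossings :: "int \<Rightarrow> int \<Rightarrow> (int \<Rightarrow> nat) \<Rightarrow> (int list \<times> int list) set" where
  "crossings e g f = {(us, vs).
     successively (\<lambda>a b. b \<le> a + 2) (e # us) \<and> last (e # us) = g - 1 \<and>
     successively (\<lambda>a b. b \<le> a + 2) vs \<and> (\<forall>x. count_list (us @ vs) x \<le> f x)}"

text \<open>Each passage over the empty site \<open>g\<close> uses a copy of \<open>g - 1\<close> and one of \<open>g + 1\<close>, where a start at
  \<open>g - 1\<close> counts as a copy. If one of these two sites has a single copy, a second passage is
  impossible. So the stay above \<open>g\<close> is one contiguous piece \<open>qs\<close> of the walk, and it
  is independent of the pieces \<open>us\<close> and \<open>vs\<close> below \<open>g\<close>.\<close>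

lemma walks_split_at_gap:
  fixes e g :: int and f1 f2 :: "int \<Rightarrow> nat"
  defines "S \<equiv> walks e f1" and "X \<equiv> crossings e g f1 \<times> (walks (g - 1) f2 - {[]})"
    and "glue \<equiv> (\<lambda>((us, vs), qs). us @ qs @ vs)"
  assumes f1: "\<And>x. g \<le> x \<Longrightarrow> f1 x = 0" and f2: "\<And>x. x \<le> g \<Longrightarrow> f2 x = 0"
    and e: "e < g"
    and narrow: "f1 (g - 1) + of_bool (e = g - 1) \<le> 1 \<or> f2 (g + 1) \<le> 1"
  shows "walks e (\<lambda>x. f1 x + f2 x) = S \<union> glue ` X" "S \<inter> glue ` X = {}" "inj_on glue X"
proof -
  have c1: "x < g" if "x \<in> set us" "\<And>x. count_list us x \<le> f1 x" for us x
  proof -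
    have "count_list us x \<noteq> 0" using that(1) by (simp add: count_list_0_iff)
    with that(2)[of x] f1[of x] show ?thesis by force
  qed
  have c2: "x > g" if "x \<in> set us" "\<And>x. count_list us x \<le> f2 x" for us x
  proof -
    have "count_list us x \<noteq> 0" using that(1) by (simp add: count_list_0_iff)
    with that(2)[of x] f2[of x] show ?thesis by force
  qed
  have XD: "(\<forall>x\<in>set us. x < g) \<and> (\<forall>x\<in>set vs. x < g) \<and> (\<forall>x\<in>set qs. x > g) \<and> qs \<noteq> []"
    if "((us, vs), qs) \<in> X" for us vs qs
  proof -
    have "count_list (us @ vs) x \<le> f1 x" "count_list qs x \<le> f2 x" for x
      using that by (auto simp: X_def crossings_def walks_def)
    with c1[of _ "us @ vs"] c2[of _ qs] that show ?thesis by (auto simp: X_def)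
  qed
  show "S \<inter> glue ` X = {}"
  proof (rule ccontr)
    assume "S \<inter> glue ` X \<noteq> {}"
    then obtain us vs qs where x: "((us, vs), qs) \<in> X" "us @ qs @ vs \<in> S"
      by (auto simp: glue_def)
    then have "hd qs > g" "hd qs \<in> set (us @ qs @ vs)" using XD[OF x(1)] by auto
    with c1[of "hd qs" "us @ qs @ vs"] x(2) show False by (auto simp: S_def walks_def)
  qed
  show "inj_on glue X"
  proof (rule inj_on_inverseI)
    let ?below = "\<lambda>x. x < g" and ?above = "\<lambda>x. x > g"
    let ?unglue = "\<lambda>ws. ((takeWhile ?below ws, dropWhile ?above (dropWhile ?below ws)),
      takeWhile ?above (dropWhile ?below ws))"
    fix x assume x: "x \<in> X"
    obtain us vs qs where x_eq: "x = ((us, vs), qs)" by (metis surj_pair)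
    note d = XD[OF x[unfolded x_eq]]
    obtain q qs' where q: "qs = q # qs'" using d by (cases qs) auto
    have "takeWhile ?below (us @ qs @ vs) = us" "dropWhile ?below (us @ qs @ vs) = qs @ vs"
      using d q by auto
    moreover have "takeWhile ?above (qs @ vs) = qs" "dropWhile ?above (qs @ vs) = vs"
      using d by (cases vs; auto)+
    ultimately show "?unglue (glue x) = x" by (simp add: glue_def x_eq)
  qed
  show "walks e (\<lambda>x. f1 x + f2 x) = S \<union> glue ` X"
  proof (intro equalityI subsetI)
    fix ws assume ws: "ws \<in> walks e (\<lambda>x. f1 x + f2 x)"
    then have suc: "successively (\<lambda>a b. b \<le> a + 2) (e # ws)"
      and cnt: "\<And>x. count_list ws x \<le> f1 x + f2 x" by (auto simp: walks_def)
    have g: "g \<notin> set ws" using walk_site[OF ws, of g] f1 f2 by auto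
    show "ws \<in> S \<union> glue ` X"
    proof (cases "\<exists>x\<in>set ws. g < x")
      case False
      then have "count_list ws x \<le> f1 x" for x
        using cnt[of x] f2[of x] by (cases "x \<in> set ws") (auto simp: count_notin)
      then show ?thesis using suc by (simp add: S_def walks_def)
    next
      case True
      define us where "us = takeWhile (\<lambda>x. x < g) ws"
      define rs where "rs = dropWhile (\<lambda>x. x < g) ws"
      define qs where "qs = takeWhile (\<lambda>x. x > g) rs"
      define vs where "vs = dropWhile (\<lambda>x. x > g) rs"
      have ws_eq: "ws = us @ qs @ vs" by (simp add: us_def rs_def qs_def vs_def)
      have us: "\<forall>x\<in>set us. x < g" unfolding us_def by (auto dest: set_takeWhileD)
      have qs: "\<forall>x\<in>set qs. x > g" unfolding qs_def by (auto dest: set_takeWhileD)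
      have "rs \<noteq> []" using True by (force simp: rs_def)
      then have "\<not> hd rs < g" "hd rs \<in> set ws" unfolding rs_def
        using hd_dropWhile[of "\<lambda>x. x < g" ws] set_dropWhileD[of _ "\<lambda>x. x < g" ws] by (auto dest: hd_in_set)
      then have "hd rs > g" using g by (metis linorder_cases)
      then have qs_ne: "qs \<noteq> []" using \<open>rs \<noteq> []\<close> by (cases rs) (auto simp: qs_def)
      have suc_us: "successively (\<lambda>a b. b \<le> a + 2) (e # us)"
        and suc_vs: "successively (\<lambda>a b. b \<le> a + 2) vs"
        and suc_qs: "successively (\<lambda>a b. b \<le> a + 2) qs"
        and step: "hd qs \<le> last (e # us) + 2"
        using suc qs_ne unfolding ws_eq
        by (auto simp: successively_append_iff simp flip: append_Cons)
      have "last (e # us) < g" using us e by auto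
      moreover have "hd qs > g" using qs qs_ne by auto
      ultimately have last_us: "last (e # us) = g - 1" and hd_qs: "hd qs = g + 1"
        using step by auto
      have vs: "\<forall>x\<in>set vs. x < g"
      proof (cases vs)
        case (Cons v vs')
        have "\<not> v > g" using Cons unfolding vs_def dropWhile_eq_Cons_conv by blast
        moreover have "v \<noteq> g" using g Cons by (auto simp: ws_eq)
        ultimately have v: "v < g" by simp
        show ?thesis
        proof (rule ccontr)
          assume "\<not> ?thesis"
          then obtain x where x: "x \<in> set vs" "g \<le> x" by auto
          with v g Cons have "x \<in> set vs'" "g < x" by (auto simp: ws_eq order.order_iff_strict)
          \<comment> \<open>A return above \<open>g\<close> within \<open>vs\<close> would be a second passage.\<close>
          with walk_crossing[of v vs' g x] suc_vs v g Cons
          have again: "g - 1 \<in> set vs" "g + 1 \<in> set vs" by (auto simp: ws_eq)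
          then have "0 < count_list vs (g - 1)" "0 < count_list vs (g + 1)"
            by (metis count_list_0_iff gr0I)+
          moreover have "0 < count_list qs (g + 1)" using hd_qs qs_ne
            by (metis count_list_0_iff gr0I hd_in_set)
          moreover have "0 < count_list us (g - 1) + of_bool (e = g - 1)"
            using last_us by (cases "us = []") (auto, metis count_list_0_iff last_in_set neq0_conv)
          ultimately have "2 \<le> count_list ws (g + 1)" "2 \<le> count_list ws (g - 1) + of_bool (e = g - 1)"
            by (auto simp: ws_eq)
          with cnt[of "g + 1"] cnt[of "g - 1"] f1[of "g + 1"] f2[of "g - 1"] narrow
          show False by linarith
        qed
      qed simp
      have "count_list (us @ vs) x \<le> f1 x" for x
      proof (cases "x < g")
        case False
        then have "x \<notin> set us" "x \<notin> set vs" using us vs by auto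
        then show ?thesis by simp
      qed (use cnt[of x] f2[of x] in \<open>simp add: ws_eq\<close>)
      moreover have "count_list qs x \<le> f2 x" for x
      proof (cases "x > g")
        case False
        then have "x \<notin> set qs" using qs by auto
        then show ?thesis by simp
      qed (use cnt[of x] f1[of x] in \<open>simp add: ws_eq\<close>)
      ultimately have "((us, vs), qs) \<in> X"
        using suc_us suc_vs suc_qs last_us hd_qs qs_ne
        by (cases qs) (auto simp: X_def crossings_def walks_def)
      then show ?thesis by (force simp: ws_eq glue_def)
    qed
  next
    fix ws assume "ws \<in> S \<union> glue ` X"
    then show "ws \<in> walks e (\<lambda>x. f1 x + f2 x)"
    proof
      assume "ws \<in> S" then show ?thesis by (auto simp: S_def walks_def intro: trans_le_add1)
    next
      assume "ws \<in> glue ` X"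
      then obtain us vs qs where x: "((us, vs), qs) \<in> X" "ws = us @ qs @ vs" by (auto simp: glue_def)
      note d = XD[OF x(1)]
      have "vs = [] \<or> hd vs \<le> last qs + 2"
        using d by (cases "vs = []") (smt (verit) hd_in_set last_in_set)+
      moreover have "successively (\<lambda>a b. b \<le> a + 2) (e # us)" "last (e # us) = g - 1"
        "successively (\<lambda>a b. b \<le> a + 2) qs" "hd qs \<le> g + 1" "successively (\<lambda>a b. b \<le> a + 2) vs"
        using x(1) d by (auto simp: X_def crossings_def walks_def successively_Cons)
      ultimately have "successively (\<lambda>a b. b \<le> a + 2) ((e # us) @ qs @ vs)"
        unfolding successively_append_iff using d by auto
      moreover have "count_list ws y \<le> f1 y + f2 y" for y
      proof -
        have "count_list (us @ vs) y \<le> f1 y" "count_list qs y \<le> f2 y"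
          using x(1) by (auto simp: X_def crossings_def walks_def)
        then show ?thesis by (simp add: x(2))
      qed
      ultimately show ?thesis by (simp add: walks_def x(2))
    qed
  qed
qed

section \<open>Backward moves of Bulgarian Solitaire\<close>

lemma desc_eqI:
  fixes xs ys :: "nat list"
  assumes "sorted_wrt (\<ge>) xs" "sorted_wrt (\<ge>) ys" "mset xs = mset ys"
  shows "xs = ys"
proof -
  have "sorted (rev xs)" "sorted (rev ys)" using assms(1,2) by (simp_all add: sorted_wrt_rev)
  moreover have "mset (rev xs) = mset (rev ys)" using assms(3) by simp
  ultimately have "rev xs = rev ys" by (metis properties_for_sort)
  then show ?thesis by simp
qed

lemma mset_bulgarian:
  "mset (bulgarian xs) = filter_mset ((<) 0) (add_mset (length xs) (image_mset (\<lambda>x. x - 1) (mset xs)))"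
  by (simp add: bulgarian_def mset_filter)

lemma desc_bulgarian: "sorted_wrt (\<ge>) (bulgarian xs)"
  by (simp add: bulgarian_def sorted_wrt_rev)

text \<open>The predecessor of \<open>xs\<close> in which \<open>k\<close> was the number of parts.\<close>

definition unplay :: "nat list \<Rightarrow> nat \<Rightarrow> nat list" where
  "unplay xs k = map Suc (remove1 k xs) @ replicate (k + 1 - length xs) 1"

lemma sorted_wrt_remove1:
  "sorted_wrt P xs \<Longrightarrow> sorted_wrt P (remove1 k xs)"
proof (induction xs)
  case (Cons x xs)
  then show ?case using set_remove1_subset[of k xs] by auto
qed simp

lemma Suc_length_remove1: "k \<in> set xs \<Longrightarrow> Suc (length (remove1 k xs)) = length xs"
proof (induction xs)
  case (Cons x xs)
  then show ?case by (cases "x = k") auto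
qed simp

lemma length_unplay:
  assumes "k \<in> set xs" "length xs \<le> k + 1"
  shows "length (unplay xs k) = k"
proof -
  have "length xs = Suc (length (remove1 k xs))"
    using Suc_length_remove1[OF assms(1)] by simp
  then show ?thesis using assms(2) by (simp add: unplay_def)
qed

lemma unplay_partition:
  assumes "xs \<in> partitions n" "k \<in> set xs" "length xs \<le> k + 1"
  shows "unplay xs k \<in> partitions n"
proof -
  have "sorted_wrt (\<ge>) (replicate c (1::nat))" for c by (induction c) auto
  then have desc: "sorted_wrt (\<ge>) (unplay xs k)"
    using assms(1) by (simp add: unplay_def partitions_def sorted_wrt_append sorted_wrt_map
        sorted_wrt_remove1)
  have "sum_list xs = k + sum_list (remove1 k xs)"
    using sum_list_map_remove1[OF assms(2), of id] by simp
  moreover have "sum_list (map Suc ys) = length ys + sum_list ys" for ys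
    by (induction ys) auto
  moreover have "length xs = Suc (length (remove1 k xs))"
    using Suc_length_remove1[OF assms(2)] by simp
  ultimately have "sum_list (unplay xs k) = n"
    using assms by (simp add: unplay_def partitions_def sum_list_replicate)
  with desc show ?thesis by (auto simp: partitions_def unplay_def)
qed

lemma bulgarian_unplay:
  assumes "xs \<in> partitions n" "k \<in> set xs" "length xs \<le> k + 1"
  shows "bulgarian (unplay xs k) = xs"
proof (rule desc_eqI)
  show "sorted_wrt (\<ge>) xs" using assms by (simp add: partitions_def)
  have pos: "\<forall>x\<in>#mset xs. 0 < x" using assms by (simp add: partitions_def)
  have "mset (bulgarian (unplay xs k)) = filter_mset ((<) 0) (add_mset k (mset xs - {#k#}) )"
    unfolding mset_bulgarian length_unplay[OF assms(2,3)]
    by (simp add: unplay_def image_mset.compositionality o_def mset_replicate)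
  also have "\<dots> = mset xs" using pos assms(2) by (simp add: filter_mset_eq_conv)
  finally show "mset (bulgarian (unplay xs k)) = mset xs" .
qed (rule desc_bulgarian)

text \<open>The newly added part of \<open>bulgarian ys\<close> is the number of parts of \<open>ys\<close>; the parts of \<open>ys\<close> that
  vanished are exactly its ones. So the predecessors of a partition \<open>xs\<close> are the \<open>unplay xs k\<close>, one
  for each part size \<open>k\<close> with \<open>length xs \<le> k + 1\<close>.\<close>

lemma unplay_bulgarian:
  assumes "ys \<in> partitions n" "bulgarian ys \<noteq> []"
  shows "length ys \<in> set (bulgarian ys)" "length (bulgarian ys) \<le> length ys + 1"
    "unplay (bulgarian ys) (length ys) = ys"
proof -
  have ne: "ys \<noteq> []" using assms(2) by (auto simp: bulgarian_def)
  then show mem: "length ys \<in> set (bulgarian ys)"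
    by (simp add: bulgarian_def set_insort_key)
  have "length (filter P zs) \<le> length zs" for P and zs :: "nat list" by simp
  from this[of _ "length ys # map (\<lambda>x. x - 1) ys"]
  show len: "length (bulgarian ys) \<le> length ys + 1" by (simp add: bulgarian_def)
  show "unplay (bulgarian ys) (length ys) = ys"
  proof (rule desc_eqI)
    show "sorted_wrt (\<ge>) ys" using assms by (simp add: partitions_def)
    show "sorted_wrt (\<ge>) (unplay (bulgarian ys) (length ys))"
      using unplay_partition[OF bulgarian_partitions[OF assms(1)] mem len] by (simp add: partitions_def)
    have im: "image_mset Suc (filter_mset ((<) 0) (image_mset (\<lambda>x. x - 1) M)) = filter_mset ((<) 1) M"
      for M by (induction M) auto
    have "mset (remove1 (length ys) (bulgarian ys)) = filter_mset ((<) 0) (image_mset (\<lambda>x. x - 1) (mset ys))"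
      using ne by (simp add: mset_bulgarian)
    then have "mset (map Suc (remove1 (length ys) (bulgarian ys))) = filter_mset ((<) 1) (mset ys)"
      using im[of "mset ys"] by simp
    moreover have "\<forall>x\<in>#mset ys. 0 < x" using assms by (simp add: partitions_def)
    then have "filter_mset (\<lambda>x. \<not> 1 < x) (mset ys) = filter_mset (\<lambda>x. x = 1) (mset ys)"
      by (intro filter_mset_cong) (auto simp: Suc_le_eq not_less le_less_Suc_eq)
    then have "mset ys = filter_mset ((<) 1) (mset ys) + replicate_mset (count (mset ys) 1) 1"
      by (metis multiset_partition filter_eq_replicate_mset)
    ultimately have e: "mset (unplay (bulgarian ys) (length ys)) =
        filter_mset ((<) 1) (mset ys) + replicate_mset (length ys + 1 - length (bulgarian ys)) 1"
      and ys: "mset ys = filter_mset ((<) 1) (mset ys) + replicate_mset (count (mset ys) 1) 1"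
      by (simp_all add: unplay_def)
    have "size (mset (unplay (bulgarian ys) (length ys))) = size (mset ys)"
      using length_unplay[OF mem len] by simp
    then have "length ys + 1 - length (bulgarian ys) = count (mset ys) 1"
      unfolding e using arg_cong[OF ys, of size] by (simp del: count_mset)
    with e ys show "mset (unplay (bulgarian ys) (length ys)) = mset ys" by metis
  qed
qed

text \<open>Parts are negated so that large parts are low sites. The guard excludes the sites
  \<open>y \<ge> 0\<close>, on which \<open>nat (- y)\<close> would be meaningless.\<close>

definition part_sites :: "nat list \<Rightarrow> int \<Rightarrow> nat" where
  "part_sites xs y = (if y < 0 then count_list xs (nat (- y)) else 0)"

lemma part_sites_eq_0: 
  assumes "y < - int (sum_list xs)"
  shows "part_sites xs y = 0"
proof -
  have "nat (- y) \<notin> set xs" using assms member_le_sum_list[of "nat (- y)" xs] by auto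
  then show ?thesis by (simp add: part_sites_def count_notin)
qed

lemma part_sites_unplay:
  assumes "k \<in> set xs" "0 < k" "y < 0"
  shows "part_sites (unplay xs k) (y - 1) = ((part_sites xs)(- int k := part_sites xs (- int k) - 1)) y"
proof -
  obtain x where y: "y = - int x" "0 < x"
    using \<open>y < 0\<close> by (metis nonpos_int_cases less_imp_le neg_less_0_iff_less of_nat_0_less_iff)
  have "nat (- (y - 1)) = Suc x" using y by simp
  moreover have "count_list (map Suc zs) (Suc x) = count_list zs x" for zs by (induction zs) auto
  moreover have "count_list (remove1 k xs) x = (if x = k then count_list xs x - 1 else count_list xs x)"
    using assms(1) by (induction xs) auto
  moreover have "count_list (replicate c 1) (Suc x) = 0" for c using y(2) by (induction c) auto
  ultimately show ?thesis using y by (auto simp: part_sites_def unplay_def)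
qed

text \<open>Taking the part \<open>k\<close> leaves \<open>k\<close> parts and raises all others by \<open>1\<close>, so the next part \<open>k'\<close> must
  satisfy \<open>k \<le> k' + 1\<close>. Measured before the raise, \<open>k'\<close> is at least \<open>k - 2\<close>: this is the bound \<open>2\<close> on
  the steps of a walk. The starting point is the part \<open>length xs\<close> that the next forward move would
  create, raised like the others. The freshly padded ones are too small to be reached
  within \<open>i\<close> moves as long as there are at least \<open>2 * i + 2\<close> parts.\<close>

lemma card_backward_plays:
  assumes "xs \<in> partitions n" "2 * i + 2 \<le> length xs"
  shows "card {ys \<in> partitions n. (bulgarian ^^ i) ys = xs} =
    card {ws \<in> walks (- int (length xs) - 1) (part_sites xs). length ws = i}"
  using assms
proof (induction i arbitrary: xs)
  case 0
  then have "{ys \<in> partitions n. (bulgarian ^^ 0) ys = xs} = {xs}" by auto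
  moreover have "{ws \<in> walks (- int (length xs) - 1) (part_sites xs). length ws = 0} = {[]}"
    by (auto simp: walks_def)
  ultimately show ?case by simp
next
  case (Suc i)
  define I where "I = {k \<in> set xs. length xs \<le> k + 1}"
  have pos: "0 < k" if "k \<in> set xs" for k using that Suc.prems(1) by (auto simp: partitions_def)
  have un: "unplay xs k \<in> partitions n" "bulgarian (unplay xs k) = xs" "length (unplay xs k) = k"
    if "k \<in> I" for k
    using that unplay_partition[OF Suc.prems(1)] bulgarian_unplay[OF Suc.prems(1)] length_unplay
    by (auto simp: I_def)
  have "{ys \<in> partitions n. (bulgarian ^^ Suc i) ys = xs} =
    (\<Union>k\<in>I. {ys \<in> partitions n. (bulgarian ^^ i) ys = unplay xs k})"
  proof (intro equalityI subsetI)
    fix ys assume "ys \<in> {ys \<in> partitions n. (bulgarian ^^ Suc i) ys = xs}"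
    then have ys: "ys \<in> partitions n" "bulgarian ((bulgarian ^^ i) ys) = xs" by auto
    have zs: "(bulgarian ^^ i) ys \<in> partitions n"
      using ys(1) by (induction i) (auto simp: bulgarian_partitions)
    have "xs \<noteq> []" using Suc.prems by auto
    with unplay_bulgarian[OF zs] ys
    show "ys \<in> (\<Union>k\<in>I. {ys \<in> partitions n. (bulgarian ^^ i) ys = unplay xs k})"
      by (auto simp: I_def)
  qed (use un in auto)
  also have "card \<dots> = (\<Sum>k\<in>I. card {ys \<in> partitions n. (bulgarian ^^ i) ys = unplay xs k})"
  proof (rule card_UN_disjoint)
    show "\<forall>k\<in>I. \<forall>l\<in>I. k \<noteq> l \<longrightarrow> {ys \<in> partitions n. (bulgarian ^^ i) ys = unplay xs k} \<inter>
       {ys \<in> partitions n. (bulgarian ^^ i) ys = unplay xs l} = {}"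
    proof (intro ballI impI)
      fix k l assume "k \<in> I" "l \<in> I" "k \<noteq> l"
      then have "unplay xs k \<noteq> unplay xs l" using un(3) by metis
      then show "{ys \<in> partitions n. (bulgarian ^^ i) ys = unplay xs k} \<inter>
        {ys \<in> partitions n. (bulgarian ^^ i) ys = unplay xs l} = {}" by auto
    qed
  qed (auto simp: I_def intro: finite_subset[OF _ finite_partitions[of n]])
  also have "\<dots> = (\<Sum>k\<in>I. card {ws \<in> walks (- int k)
      ((part_sites xs)(- int k := part_sites xs (- int k) - 1)). length ws = i})"
  proof (rule sum.cong[OF refl])
    fix k assume k: "k \<in> I"
    let ?f = "(part_sites xs)(- int k := part_sites xs (- int k) - 1)"
    have big: "2 * i + 3 \<le> k" using k Suc.prems(2) by (auto simp: I_def)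
    have "card {ys \<in> partitions n. (bulgarian ^^ i) ys = unplay xs k} =
      card {ws \<in> walks (- int k + (- 1)) (part_sites (unplay xs k)). length ws = i}"
      using Suc.IH[of "unplay xs k"] un[OF k] big by simp
    \<comment> \<open>The shift by \<open>- 1\<close> compensates the raise of all remaining parts.\<close>
    also have "\<dots> = card {ws \<in> walks (- int k) (\<lambda>y. part_sites (unplay xs k) (y + (- 1))). length ws = i}"
      by (rule card_walks_shift)
    also have "{ws \<in> walks (- int k) (\<lambda>y. part_sites (unplay xs k) (y + (- 1))). length ws = i} =
      {ws \<in> walks (- int k) ?f. length ws = i}"
    proof (rule walks_cong)
      fix y assume "y \<le> - int k + 2 * int i"
      then have "y < 0" using big by simp
      then show "part_sites (unplay xs k) (y + (- 1)) = ?f y"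
        using part_sites_unplay[of k xs y] k pos by (simp add: I_def)
    qed
    finally show "card {ys \<in> partitions n. (bulgarian ^^ i) ys = unplay xs k} =
      card {ws \<in> walks (- int k) ?f. length ws = i}" .
  qed
  also have "\<dots> = (\<Sum>w | w \<le> - int (length xs) - 1 + 2 \<and> 0 < part_sites xs w.
      card {ws \<in> walks w ((part_sites xs)(w := part_sites xs w - 1)). length ws = i})"
  proof (rule sum.reindex_bij_betw)
    have "(\<lambda>k. - int k) ` I = {w. w \<le> - int (length xs) - 1 + 2 \<and> 0 < part_sites xs w}"
    proof (intro equalityI subsetI)
      fix w assume "w \<in> (\<lambda>k. - int k) ` I"
      then obtain k where k: "w = - int k" "k \<in> set xs" "length xs \<le> k + 1" by (auto simp: I_def)
      with pos[OF k(2)] have "count_list xs k \<noteq> 0" by (simp add: count_list_0_iff)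
      with k pos[OF k(2)] show "w \<in> {w. w \<le> - int (length xs) - 1 + 2 \<and> 0 < part_sites xs w}"
        by (auto simp: part_sites_def)
    next
      fix w assume w: "w \<in> {w. w \<le> - int (length xs) - 1 + 2 \<and> 0 < part_sites xs w}"
      then have "w < 0" "count_list xs (nat (- w)) \<noteq> 0" by (auto simp: part_sites_def split: if_splits)
      then have "nat (- w) \<in> I" "w = - int (nat (- w))" using w by (auto simp: I_def count_list_0_iff)
      then show "w \<in> (\<lambda>k. - int k) ` I" by blast
    qed
    then show "bij_betw (\<lambda>k. - int k) I {w. w \<le> - int (length xs) - 1 + 2 \<and> 0 < part_sites xs w}"
      by (auto simp: bij_betw_def inj_on_def)
  qed
  also have "\<dots> = card {ws \<in> walks (- int (length xs) - 1) (part_sites xs). length ws = Suc i}"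
    by (rule card_walks_Suc[symmetric]) (rule part_sites_eq_0)
  finally show ?case .
qed

section \<open>Recurrent cycles\<close>

fun staircase_plus :: "nat list \<Rightarrow> nat list" where
  "staircase_plus [] = []"
| "staircase_plus (a # s) = (length s + a) # staircase_plus s"

lemma length_staircase_plus [simp]: "length (staircase_plus s) = length s"
  by (induction s) auto

lemma nth_staircase_plus:
  "t < length s \<Longrightarrow> staircase_plus s ! t = (length s - 1 - t) + s ! t"
  by (induction s arbitrary: t) (auto simp: nth_Cons split: nat.splits)

lemma staircase_plus_snoc: "staircase_plus (s @ [a]) = map Suc (staircase_plus s) @ [a]"
  by (induction s) auto

lemma staircase_plus_le:
  "set s \<subseteq> {0, 1} \<Longrightarrow> x \<in> set (staircase_plus s) \<Longrightarrow> x \<le> length s"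
  by (induction s) force+

lemma desc_staircase_plus: "set s \<subseteq> {0, 1} \<Longrightarrow> sorted_wrt (\<ge>) (staircase_plus s)"
proof (induction s)
  case (Cons a s)
  then have "\<forall>x\<in>set (staircase_plus s). x \<le> length s" using staircase_plus_le[of s] by auto
  with Cons show ?case by (auto intro: trans_le_add1)
qed simp

lemma sum_list_staircase_plus:
  "sum_list (staircase_plus s) = (length s choose 2) + sum_list s"
  by (induction s) (auto simp: numeral_2_eq_2)

definition cyclic_partition :: "nat list \<Rightarrow> nat list" where
  "cyclic_partition s = filter ((<) 0) (staircase_plus s)"

lemma cyclic_partition:
  assumes "set s \<subseteq> {0, 1}"
  shows "cyclic_partition s \<in> partitions ((length s choose 2) + sum_list s)"
proof -
  have "sum_list (filter ((<) 0) ys) = sum_list ys" for ys :: "nat list"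
    by (induction ys) auto
  then show ?thesis using assms
    by (simp add: partitions_def cyclic_partition_def sum_list_staircase_plus desc_staircase_plus
        sorted_wrt_filter)
qed

lemma pad_filter_pos:
  assumes "sorted_wrt (\<ge>) ys"
  shows "pad (length ys) (filter ((<) 0) ys) = ys"
  using assms
proof (induction ys)
  case (Cons y ys)
  show ?case
  proof (cases "y = 0")
    case True
    with Cons.prems have "\<forall>x\<in>set ys. x = 0" by auto
    then have "filter ((<) 0) ys = []" "ys = replicate (length ys) 0"
      by (auto simp: filter_empty_conv replicate_length_same)
    with True show ?thesis by (simp add: pad_def)
  next
    case False
    have "length (filter ((<) 0) ys) \<le> length ys" by simp
    with False Cons show ?thesis by (simp add: pad_def)
  qed
qed (simp add: pad_def)

lemma pad_eq_staircase_plus_iff: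
  assumes "set s \<subseteq> {0, 1}" "\<forall>x\<in>set xs. 0 < x" "length xs \<le> length s"
  shows "pad (length s) xs = staircase_plus s \<longleftrightarrow> xs = cyclic_partition s"
proof
  assume "pad (length s) xs = staircase_plus s"
  moreover have "filter ((<) 0) (pad (length s) xs) = xs"
    using assms(2) by (simp add: pad_def filter_id_conv)
  ultimately show "xs = cyclic_partition s" by (simp add: cyclic_partition_def)
next
  assume "xs = cyclic_partition s"
  with pad_filter_pos[OF desc_staircase_plus[OF assms(1)]]
  show "pad (length s) xs = staircase_plus s" by (simp add: cyclic_partition_def)
qed

lemma staircase_diff_eq_iff:
  assumes "length xs \<le> length s"
  shows "staircase_diff (length s) xs = map int s \<longleftrightarrow> pad (length s) xs = staircase_plus s"
proof -
  let ?m = "length s"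
  have len: "length (pad ?m xs) = ?m" using assms by (simp add: pad_def)
  have "staircase_diff ?m xs ! t = int s' \<longleftrightarrow> pad ?m xs ! t = (?m - 1 - t) + s'"
    if "t < ?m" for t s'
    using that len by (auto simp: staircase_diff_def rev_nth)
  then show ?thesis
    using len by (auto simp: list_eq_iff_nth_eq nth_staircase_plus) (auto simp: staircase_diff_def)
qed

lemma length_cyclic_partition:
  assumes "set (s @ [a]) \<subseteq> {0, 1}"
  shows "length (cyclic_partition (s @ [a])) = length s + a"
proof -
  have "filter ((<) 0) (map Suc zs) = map Suc zs" for zs by (simp add: filter_id_conv)
  then show ?thesis using assms by (auto simp: cyclic_partition_def staircase_plus_snoc)
qed

text \<open>On the \<open>0/1\<close> vector attached to a recurrent partition, the Solitaire map is rotation: the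
  number of parts is \<open>length s + a\<close>, the entry of the staircase that heads the list, and
  subtracting \<open>1\<close> moves every other entry one place down the staircase.\<close>

lemma bulgarian_cyclic_partition:
  assumes "set (s @ [a]) \<subseteq> {0, 1}"
  shows "bulgarian (cyclic_partition (s @ [a])) = cyclic_partition (a # s)"
proof (rule desc_eqI)
  show "sorted_wrt (\<ge>) (cyclic_partition (a # s))"
    using assms desc_staircase_plus[of "a # s"] by (auto simp: cyclic_partition_def sorted_wrt_filter)
  have *: "filter_mset ((<) 0) (image_mset (\<lambda>x. x - 1) (filter_mset ((<) 0) M)) =
      filter_mset ((<) 0) (image_mset (\<lambda>x::nat. x - 1) M)" for M
    by (induction M) auto
  show "mset (bulgarian (cyclic_partition (s @ [a]))) = mset (cyclic_partition (a # s))"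
    unfolding mset_bulgarian length_cyclic_partition[OF assms] filter_mset_add_mset
    using assms
    by (auto simp: cyclic_partition_def staircase_plus_snoc mset_filter * image_mset.compositionality o_def
       simp flip: mset_map)
qed (rule desc_bulgarian)

definition bits :: "bead list \<Rightarrow> nat list" where
  "bits u = map (\<lambda>b. of_bool (b = Black)) u"

lemma length_bits [simp]: "length (bits u) = length u" by (simp add: bits_def)

lemma set_bits: "set (bits u) \<subseteq> {0, 1}" by (auto simp: bits_def)

lemma nth_bits: "t < length u \<Longrightarrow> bits u ! t = of_bool (u ! t = Black)" by (simp add: bits_def)

lemma sum_list_bits: "sum_list (bits u) = count_list u Black"
  by (induction u) (auto simp: bits_def)

lemma bits_inj: "bits u = bits v \<longleftrightarrow> u = v"
proof -
  have "inj (\<lambda>b. of_bool (b = Black) :: nat)"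
  proof (rule injI)
    fix b c :: bead assume "of_bool (b = Black) = (of_bool (c = Black) :: nat)"
    then show "b = c" by (cases b; cases c) auto
  qed
  then show ?thesis unfolding bits_def by (simp add: inj_map_eq_map)
qed

lemma necklace_of_eq_iff: "necklace_of u = necklace_of w \<longleftrightarrow> (\<exists>r. u = rotate r w)"
proof -
  have "necklace_of u = necklace_of w \<longleftrightarrow> necklace_of w = necklace_of u" by auto
  also have "\<dots> \<longleftrightarrow> rotation_equiv w u" by transfer simp
  finally show ?thesis by (simp add: rotation_equiv_def)
qed

lemma encodes_necklace_of_iff:
  "encodes v (necklace_of w) \<longleftrightarrow> (\<exists>r. v = map int (bits (rotate r w)))"
proof -
  let ?dec = "map (\<lambda>x::int. if x = 1 then Black else White)"
  have dec: "?dec (map int (bits u)) = u" for u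
    by (induction u) (auto simp: bits_def intro: bead.exhaust)
  have enc: "map int (bits (?dec v)) = v" if "set v \<subseteq> {0, 1}"
    using that by (induction v) (auto simp: bits_def)
  have "set (map int (bits u)) \<subseteq> {0, 1}" for u using set_bits[of u] by auto
  with dec enc show ?thesis unfolding encodes_def necklace_of_eq_iff by metis
qed

lemma necklace_length_of [simp]: "necklace_length (necklace_of w) = length w"
  by transfer simp

lemma orbit_weight_of: "orbit_weight (necklace_of w) = (length w choose 2) + sum_list (bits w)"
proof -
  have "black_beads (necklace_of w) = count_list w Black" by transfer simp
  then show ?thesis by (simp add: orbit_weight_def sum_list_bits)
qed

lemma sum_list_bits_rotate: "sum_list (bits (rotate r w)) = sum_list (bits w)"
proof -
  have "mset (rotate r w) = mset w"
    by (metis append_take_drop_id mset_append rotate_drop_take union_commute)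
  then show ?thesis unfolding sum_list_bits by (metis count_mset)
qed

lemma recurrent_cycle_of:
  assumes "w \<noteq> []"
  shows "recurrent_cycle (necklace_of w) = (\<lambda>u. cyclic_partition (bits u)) ` range (\<lambda>r. rotate r w)"
    (is "?C = ?f ` ?R")
proof (intro equalityI subsetI)
  fix xs assume xs: "xs \<in> ?C"
  then have len: "length xs \<le> length w" and pos: "\<forall>x\<in>set xs. 0 < x"
    by (auto simp: recurrent_cycle_def partitions_def)
  from xs obtain r where "staircase_diff (length w) xs = map int (bits (rotate r w))"
    by (auto simp: recurrent_cycle_def encodes_necklace_of_iff)
  with len pos have "xs = ?f (rotate r w)"
    using staircase_diff_eq_iff[of xs "bits (rotate r w)"] set_bits[of "rotate r w"]
      pad_eq_staircase_plus_iff[of "bits (rotate r w)" xs] by simp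
  then show "xs \<in> ?f ` ?R" by blast
next
  fix xs assume "xs \<in> ?f ` ?R"
  then obtain r where xs: "xs = ?f (rotate r w)" by auto
  have part: "xs \<in> partitions (orbit_weight (necklace_of w))"
    using cyclic_partition[OF set_bits, of "rotate r w"]
    by (simp add: xs orbit_weight_of sum_list_bits_rotate)
  have "length xs \<le> length (staircase_plus (bits (rotate r w)))"
    unfolding xs cyclic_partition_def by (rule length_filter_le)
  then have len: "length xs \<le> length w" by simp
  have "staircase_diff (length w) xs = map int (bits (rotate r w))"
    using staircase_diff_eq_iff[of xs "bits (rotate r w)"] set_bits[of "rotate r w"] len part
      pad_eq_staircase_plus_iff[of "bits (rotate r w)" xs] xs by (simp add: partitions_def)
  with len part show "xs \<in> ?C" by (auto simp: recurrent_cycle_def encodes_necklace_of_iff)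
qed

lemma inj_on_cyclic_partition:
  "inj_on (\<lambda>u. cyclic_partition (bits u)) (range (\<lambda>r. rotate r w))"
proof (rule inj_onI)
  fix u v assume uv: "u \<in> range (\<lambda>r. rotate r w)" "v \<in> range (\<lambda>r. rotate r w)"
    "cyclic_partition (bits u) = cyclic_partition (bits v)"
  then have len: "length u = length w" "length v = length w" by auto
  have "staircase_plus (bits u) = staircase_plus (bits v)"
    using uv(3) pad_filter_pos[OF desc_staircase_plus[OF set_bits]] len
    by (metis cyclic_partition_def length_bits length_staircase_plus)
  then have "bits u ! t = bits v ! t" if "t < length w" for t
    using that len nth_staircase_plus[of t "bits u"] nth_staircase_plus[of t "bits v"] by simp
  then have "bits u = bits v" using len by (simp add: list_eq_iff_nth_eq)
  then show "u = v" by (simp add: bits_inj)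
qed

text \<open>Once a partition has entered the cycle, it stays there. This is what turns the level count
  into a difference in \<open>coeff_level_poly\<close>.\<close>

lemma bulgarian_recurrent_cycle:
  assumes "w \<noteq> []" "xs \<in> recurrent_cycle (necklace_of w)"
  shows "bulgarian xs \<in> recurrent_cycle (necklace_of w)"
proof -
  obtain r where xs: "xs = cyclic_partition (bits (rotate r w))"
    using assms by (auto simp: recurrent_cycle_of)
  obtain u b where u: "rotate r w = u @ [b]"
    using assms(1) by (metis rev_exhaust rotate_is_Nil_conv)
  then have "b # u = rotate (length u) (rotate r w)" by (simp add: rotate_append)
  then have rot: "b # u = rotate (length u + r) w" by (simp add: rotate_rotate)
  have "bits (u @ [b]) = bits u @ [of_bool (b = Black)]" "bits (b # u) = of_bool (b = Black) # bits u"
    by (simp_all add: bits_def)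
  then have "bulgarian xs = cyclic_partition (bits (b # u))"
    using bulgarian_cyclic_partition[of "bits u" "of_bool (b = Black)"] set_bits[of "u @ [b]"]
    by (simp add: xs u)
  then show ?thesis using assms(1) rot by (auto simp: recurrent_cycle_of)
qed

text \<open>Partitions of level at most \<open>i\<close>.\<close>

definition reaching :: "necklace \<Rightarrow> nat \<Rightarrow> nat list set" where
  "reaching N i = {xs \<in> partitions (orbit_weight N). (bulgarian ^^ i) xs \<in> recurrent_cycle N}"

lemma finite_reaching: "finite (reaching N i)"
  by (rule finite_subset[OF _ finite_partitions]) (auto simp: reaching_def)

lemma coeff_level_poly:
  assumes "\<And>xs. xs \<in> recurrent_cycle N \<Longrightarrow> bulgarian xs \<in> recurrent_cycle N"
  shows "coeff (level_poly N) i =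
    int (card (reaching N i)) - (if i = 0 then 0 else int (card (reaching N (i - 1))))"
proof -
  have mono: "reaching N j \<subseteq> reaching N i" if "j \<le> i" for i j
    using that
  proof (induction rule: dec_induct)
    case (step m)
    then show ?case using assms by (auto simp: reaching_def)
  qed simp
  have lev: "xs \<in> orbit N \<and> level N xs = i \<longleftrightarrow> xs \<in> reaching N i \<and> (i \<noteq> 0 \<longrightarrow> xs \<notin> reaching N (i - 1))"
    for xs
  proof
    assume L: "xs \<in> orbit N \<and> level N xs = i"
    then obtain m where "xs \<in> partitions (orbit_weight N)" "(bulgarian ^^ m) xs \<in> recurrent_cycle N"
      by (auto simp: orbit_def)
    moreover from LeastI[of "\<lambda>m. (bulgarian ^^ m) xs \<in> recurrent_cycle N", OF this(2)]
    have "(bulgarian ^^ i) xs \<in> recurrent_cycle N" using L by (simp add: level_def)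
    moreover have "(bulgarian ^^ (i - 1)) xs \<notin> recurrent_cycle N" if "i \<noteq> 0"
      using not_less_Least[of "i - 1" "\<lambda>m. (bulgarian ^^ m) xs \<in> recurrent_cycle N"] L that
      by (simp add: level_def)
    ultimately show "xs \<in> reaching N i \<and> (i \<noteq> 0 \<longrightarrow> xs \<notin> reaching N (i - 1))"
      by (simp add: reaching_def)
  next
    assume R: "xs \<in> reaching N i \<and> (i \<noteq> 0 \<longrightarrow> xs \<notin> reaching N (i - 1))"
    have "level N xs = i" unfolding level_def
    proof (rule Least_equality)
      fix j assume j: "(bulgarian ^^ j) xs \<in> recurrent_cycle N"
      show "i \<le> j"
      proof (rule ccontr)
        assume "\<not> i \<le> j"
        then have "j \<le> i - 1" "i \<noteq> 0" by auto
        with j R mono[of j "i - 1"] show False by (auto simp: reaching_def)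
      qed
    qed (use R in \<open>simp add: reaching_def\<close>)
    with R show "xs \<in> orbit N \<and> level N xs = i" by (auto simp: reaching_def orbit_def)
  qed
  have "coeff (level_poly N) i = int (card {xs \<in> orbit N. level N xs = i})"
    by (simp add: level_poly_def coeff_sum sum.If_cases finite_orbit Int_def conj_commute)
  also have "{xs \<in> orbit N. level N xs = i} = reaching N i - (if i = 0 then {} else reaching N (i - 1))"
    using lev by auto
  also have "int (card \<dots>) = int (card (reaching N i)) - (if i = 0 then 0 else int (card (reaching N (i - 1))))"
    using mono[of "i - 1" i] by (simp add: card_Diff_subset finite_reaching card_mono of_nat_diff)
  finally show ?thesis .
qed

lemma card_reaching:
  assumes "w \<noteq> []"
  shows "card (reaching (necklace_of w) i) = (\<Sum>u\<in>range (\<lambda>r. rotate r w).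
    card {ys \<in> partitions (orbit_weight (necklace_of w)). (bulgarian ^^ i) ys = cyclic_partition (bits u)})"
proof -
  let ?n = "orbit_weight (necklace_of w)" and ?C = "recurrent_cycle (necklace_of w)"
  have "reaching (necklace_of w) i = (\<Union>xs\<in>?C. {ys \<in> partitions ?n. (bulgarian ^^ i) ys = xs})"
    by (auto simp: reaching_def)
  also have "card \<dots> = (\<Sum>xs\<in>?C. card {ys \<in> partitions ?n. (bulgarian ^^ i) ys = xs})"
  proof (rule card_UN_disjoint)
    show "finite ?C" 
      by (rule finite_subset[OF _ finite_partitions[of ?n]]) (auto simp: recurrent_cycle_def)
  qed (auto intro: finite_subset[OF _ finite_partitions[of ?n]])
  finally show ?thesis
    unfolding recurrent_cycle_of[OF assms] by (simp add: sum.reindex[OF inj_on_cyclic_partition])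
qed

section \<open>A bottleneck in every primitive necklace\<close>

lemma rotate_concat_replicate:
  "rotate r (concat (replicate k u)) = concat (replicate k (rotate r u))"
proof (induction r)
  case (Suc r)
  have "rotate1 (concat (replicate k v)) = concat (replicate k (rotate1 v))" for v :: "'a list"
  proof (cases v)
    case (Cons b v')
    have "concat (replicate m (b # v')) @ [b] = b # concat (replicate m (v' @ [b]))" for m
      by (induction m) auto
    with Cons show ?thesis by (cases k) auto
  qed (cases k; simp)
  with Suc show ?case by simp
qed simp

lemma length_concat_replicate [simp]: "length (concat (replicate k u)) = k * length u"
  by (induction k) auto

lemma nth_concat_replicate:
  "t < k * length u \<Longrightarrow> concat (replicate k u) ! t = u ! (t mod length u)"
proof (induction k arbitrary: t)
  case (Suc k)
  show ?case
  proof (cases "t < length u")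
    case False
    with Suc.prems have "t - length u < k * length u" by simp
    with Suc.IH False show ?thesis by (simp add: nth_append le_mod_geq)
  qed (simp add: nth_append)
qed simp

lemma necklace_power_of: "necklace_power (necklace_of u) k = necklace_of (concat (replicate k u))"
  by transfer (simp add: rotation_equiv_def, metis rotate0 id_apply)

text \<open>Otherwise every descent from black to white is preceded by white and followed by black. Then
  two adjacent black beads would force black beads ever after, so a single descent forces the word
  to alternate; an alternating necklace with at least three beads is a proper power of \<open>BW\<close>, and a
  necklace without descents is a power of a single bead.\<close>

lemma primitive_has_bottleneck:
  assumes prim: "primitive (necklace_of v)" and len: "3 \<le> length v"
  shows "\<exists>g. rotate g v ! 0 = Black \<and> rotate g v ! 1 = White \<and>
    (rotate g v ! (length v - 1) = Black \<or> rotate g v ! 2 = White)"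
proof (rule ccontr)
  define p where "p = length v"
  define b where "b j \<longleftrightarrow> v ! (j mod p) = Black" for j
  have per: "b (j + p) = b j" for j by (simp add: b_def)
  then have per_mult: "b (j + k * p) = b j" for j k
    by (simp add: b_def)
  have rot: "rotate g v ! t = (if b (g + t) then Black else White)" if "t < p" for g t
    using that bead.exhaust[of "v ! ((g + t) mod p)"] by (auto simp: b_def p_def nth_rotate)
  assume neg: "\<not> ?thesis"
  have "\<not> (b g \<and> \<not> b (g + 1) \<and> (b (g + p - 1) \<or> \<not> b (g + 2)))" for g
  proof -
    have "\<not> (rotate g v ! 0 = Black \<and> rotate g v ! 1 = White \<and>
        (rotate g v ! (p - 1) = Black \<or> rotate g v ! 2 = White))"
      using neg unfolding p_def by blast
    moreover have "0 < p" "1 < p" "2 < p" "p - 1 < p" "g + (p - 1) = g + p - 1"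
      using len by (auto simp: p_def)
    ultimately show ?thesis using rot[of 0 g] rot[of 1 g] rot[of 2 g] rot[of "p - 1" g]
      by (auto split: if_splits)
  qed
  then have no_pre: "\<not> b (g + p - 1)" and no_post: "b (g + 2)" if "b g" "\<not> b (g + 1)" for g
    using that by blast+
  have not_power: "necklace_of v \<noteq> necklace_of (concat (replicate k u))" if "2 \<le> k" for k u
    using prim that necklace_power_of unfolding primitive_def by metis
  have prop_up: "b (j + n)" if "b j" "\<And>g. b g \<Longrightarrow> j \<le> g \<Longrightarrow> b (g + 1)" for j n
    using that by (induction n) auto
  show False
  proof (cases "\<exists>g. b g \<and> \<not> b (g + 1)")
    case False
    have const: "b j = b 0" for j
    proof
      assume "b j"
      with False prop_up[of j "j * (p - 1)"] have "b (j + j * (p - 1))" by auto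
      also have "j + j * (p - 1) = 0 + j * p" using len by (cases p) (auto simp: p_def)
      finally show "b 0" using per_mult[of 0 j] by simp
    next
      assume "b 0"
      with False prop_up[of 0 j] show "b j" by auto
    qed
    have "v = concat (replicate p [v ! 0])"
    proof (rule nth_equalityI)
      fix t assume "t < length v"
      with const[of t] len show "v ! t = concat (replicate p [v ! 0]) ! t"
        by (simp add: nth_concat_replicate b_def p_def) (metis bead.exhaust)
    qed (simp add: p_def)
    with not_power[of p "[v ! 0]"] len show False by (simp add: p_def)
  next
    case True
    then obtain g where g: "b g" "\<not> b (g + 1)" by blast
    have no11: "\<not> b (h + 1)" if "b h" for h
    proof
      assume "b (h + 1)"
      have "b (h + n) \<and> b (h + n + 1)" for n
      proof (induction n)
        case (Suc n)
        have "b (h + n + 2)"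
        proof (rule ccontr)
          assume "\<not> b (h + n + 2)"
          with no_pre[of "h + n + 1"] Suc per[of "h + n"] show False by (simp add: add.commute)
        qed
        with Suc show ?case by simp
      qed (use that \<open>b (h + 1)\<close> in simp)
      from this[of "g + 1 + h * (p - 1)"] have "b (h + (g + 1 + h * (p - 1)))" by blast
      also have "h + (g + 1 + h * (p - 1)) = g + 1 + h * p" using len by (cases p) (auto simp: p_def)
      finally show False using per_mult[of "g + 1" h] g by simp
    qed
    have alt: "b (g + 2 * n) \<and> \<not> b (g + 2 * n + 1)" for n
    proof (induction n)
      case (Suc n)
      with no_post[of "g + 2 * n"] have "b (g + 2 * Suc n)" by (simp add: add.commute)
      with no11 show ?case by blast
    qed (use g in simp)
    have alt': "b (g + t) \<longleftrightarrow> even t" for t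
      using alt[of "t div 2"] by (cases "even t") (auto elim!: evenE oddE)
    have "even p" using alt'[of p] per[of g] g by simp
    have "rotate g v = concat (replicate (p div 2) [Black, White])"
    proof (rule nth_equalityI)
      have two: "length [Black, White] = 2" by simp
      fix t assume "t < length (rotate g v)"
      then have t: "t < p" by (simp add: p_def)
      then have "concat (replicate (p div 2) [Black, White]) ! t = [Black, White] ! (t mod 2)"
        using \<open>even p\<close> nth_concat_replicate[of t "p div 2" "[Black, White]", unfolded two] by simp
      also have "\<dots> = (if even t then Black else White)"
        by (cases "even t") (simp_all add: even_iff_mod_2_eq_zero odd_iff_mod_2_eq_one)
      finally show "rotate g v ! t = concat (replicate (p div 2) [Black, White]) ! t"
        using rot[OF t] alt' by simp
    next
      show "length (rotate g v) = length (concat (replicate (p div 2) [Black, White]))"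
        using \<open>even p\<close> by (simp add: p_def flip: mult_2_right)
    qed
    moreover have "necklace_of v = necklace_of (rotate g v)"
      using necklace_of_eq_iff[of "rotate g v" v] by auto
    moreover have "2 \<le> p div 2" using \<open>even p\<close> len by (auto simp: p_def elim!: evenE)
    ultimately show False using not_power by metis
  qed
qed

section \<open>Walks along a periodic word\<close>

text \<open>The word \<open>w\<close> is read periodically along the integers. In a recurrent partition of length \<open>m\<close>
  with \<open>0/1\<close> vector \<open>v\<close>, part number \<open>j\<close> is \<open>m - j + v\<^sub>j\<close>; up to the constant \<open>m\<close>, its negative is
  \<open>j - v\<^sub>j\<close>.\<close>

definition bead_pos :: "bead list \<Rightarrow> int \<Rightarrow> int" where
  "bead_pos w j = j - of_bool (w ! nat (j mod int (length w)) = Black)"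

definition sites :: "bead list \<Rightarrow> int set \<Rightarrow> int \<Rightarrow> nat" where
  "sites w I x = card {j \<in> I. bead_pos w j = x}"

text \<open>Backward plays from the recurrent partition whose word is \<open>w\<close> read from position \<open>a + 1\<close> on, in
  the limit of infinitely many parts. The number of parts of that partition is governed by bead
  \<open>a\<close>, which is cyclically the last one; hence the starting point.\<close>

definition walk_gf :: "bead list \<Rightarrow> int \<Rightarrow> int fps" where
  "walk_gf w a = ogf length (walks (bead_pos w a) (sites w {a<..}))"

lemma bead_pos_bounds: "j - 1 \<le> bead_pos w j" "bead_pos w j \<le> j"
  by (simp_all add: bead_pos_def)

lemma finite_fibre: "finite {j \<in> I. bead_pos w j = x}"
proof (rule finite_subset)
  show "{j \<in> I. bead_pos w j = x} \<subseteq> {x..x + 1}"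
  proof
    fix j assume "j \<in> {j \<in> I. bead_pos w j = x}"
    with bead_pos_bounds(1)[of j w] bead_pos_bounds(2)[of w j] show "j \<in> {x..x + 1}" by auto
  qed
qed simp

lemma sites_eq_0: "(\<And>j. j \<in> I \<Longrightarrow> bead_pos w j \<noteq> x) \<Longrightarrow> sites w I x = 0"
  unfolding sites_def by (subst card_0_eq[OF finite_fibre]) auto

lemma sites_Un_disjoint: "I \<inter> J = {} \<Longrightarrow> sites w (I \<union> J) x = sites w I x + sites w J x"
  unfolding sites_def
  by (subst card_Un_disjoint[symmetric]) (auto simp: finite_fibre intro!: arg_cong[where f = card])

lemma finite_site_walks:
  assumes "I \<subseteq> {a<..}"
  shows "finite {ws \<in> walks e (sites w I). length ws = n}"
proof (rule finite_walks)
  fix x assume x: "x < a"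
  show "sites w I x = 0"
  proof (rule sites_eq_0)
    fix j assume "j \<in> I"
    then have "a < j" using assms by auto
    with x bead_pos_bounds(1)[of j w] show "bead_pos w j \<noteq> x" by simp
  qed
qed

text \<open>The source of all degree bounds: a walk uses up one bead per step.\<close>

lemma length_le_card_sites:
  assumes "finite I" "\<And>x. count_list ws x \<le> sites w I x"
  shows "length ws \<le> card I"
proof -
  have "length ws = (\<Sum>x\<in>set ws. count_list ws x)" by (simp add: sum_count_set)
  also have "\<dots> \<le> (\<Sum>x\<in>set ws. card {j \<in> I. bead_pos w j = x})"
    by (rule sum_mono) (use assms(2) in \<open>simp add: sites_def\<close>)
  also have "\<dots> = card (\<Union>x\<in>set ws. {j \<in> I. bead_pos w j = x})"
    by (rule card_UN_disjoint[symmetric]) (auto simp: finite_fibre)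
  also have "\<dots> \<le> card I" by (rule card_mono) (use assms(1) in auto)
  finally show ?thesis .
qed

lemma walk_gf_shift:
  assumes "\<And>j. bead_pos u j = bead_pos w (j + d) - d"
  shows "walk_gf u a = walk_gf w (a + d)"
proof (rule fps_ext)
  fix n
  have "sites u {a<..} x = sites w {a + d<..} (x + d)" for x
  proof -
    have "bij_betw (\<lambda>j. j + d) {j \<in> {a<..}. bead_pos u j = x} {j \<in> {a + d<..}. bead_pos w j = x + d}"
      by (rule bij_betw_byWitness[where f' = "\<lambda>j. j - d"]) (auto simp: assms)
    then show ?thesis unfolding sites_def by (rule bij_betw_same_card)
  qed
  then have "sites u {a<..} = (\<lambda>x. sites w {a + d<..} (x + d))" by blast
  moreover have "bead_pos w (a + d) = bead_pos u a + d" by (simp add: assms)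
  ultimately show "fps_nth (walk_gf u a) n = fps_nth (walk_gf w (a + d)) n"
    by (simp add: walk_gf_def ogf_def card_walks_shift)
qed

lemma walk_gf_periodic: "walk_gf w (a + c * int (length w)) = walk_gf w a"
  by (rule walk_gf_shift[symmetric]) (simp add: bead_pos_def)

lemma walk_gf_rotate:
  assumes "w \<noteq> []"
  shows "walk_gf (rotate r w) a = walk_gf w (a + int r)"
proof (rule walk_gf_shift)
  fix j
  define t where "t = nat (j mod int (length w))"
  have t: "int t = j mod int (length w)" "t < length w"
    using assms by (simp_all add: t_def nat_less_iff)
  have "int ((r + t) mod length w) = (j + int r) mod int (length w)"
    using t(1) by (simp add: zmod_int mod_simps add.commute)
  then have "rotate r w ! t = w ! nat ((j + int r) mod int (length w))"
    using t(2) by (simp add: nth_rotate) (metis nat_int)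
  then show "bead_pos (rotate r w) j = bead_pos w (j + int r) - int r"
    by (simp add: bead_pos_def t_def)
qed

lemma finite_crossings:
  assumes "finite I"
  shows "finite (crossings e g (sites w I))"
proof -
  let ?X = "{ws. set ws \<subseteq> bead_pos w ` I \<and> length ws \<le> card I}"
  have "crossings e g (sites w I) \<subseteq> ?X \<times> ?X"
  proof (rule subrelI)
    fix us vs assume "(us, vs) \<in> crossings e g (sites w I)"
    then have cnt: "\<And>x. count_list (us @ vs) x \<le> sites w I x" by (auto simp: crossings_def)
    have "set (us @ vs) \<subseteq> bead_pos w ` I"
    proof (rule subsetI, rule ccontr)
      fix x assume x: "x \<in> set (us @ vs)" "x \<notin> bead_pos w ` I"
      then have "sites w I x = 0" by (intro sites_eq_0) auto
      with cnt[of x] x(1) show False by (auto simp: count_list_0_iff)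
    qed
    with length_le_card_sites[OF assms cnt] show "(us, vs) \<in> ?X \<times> ?X" by auto
  qed
  then show ?thesis
    by (rule finite_subset) (intro finite_cartesian_product finite_lists_length_le; use assms in simp)
qed

abbreviation pair_length :: "'a list \<times> 'b list \<Rightarrow> nat" where
  "pair_length \<equiv> \<lambda>(us, vs). length us + length vs"

section \<open>Rationality at a bottleneck\<close>

text \<open>The beads at positions \<open>0\<close> and \<open>1\<close> leave site \<open>0\<close> empty. Sites \<open>- 1\<close> and \<open>1\<close> are occupied by beads
  \<open>0\<close> and \<open>1\<close>; the last condition says that one of these two sites has no second bead.\<close>

locale bottleneck =
  fixes w :: "bead list"
  assumes long: "3 \<le> length w"
    and first: "w ! 0 = Black" and second: "w ! 1 = White"
    and narrow: "w ! (length w - 1) = Black \<or> w ! 2 = White"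
begin

definition block_gf :: "int \<Rightarrow> int fps" where
  "block_gf a = ogf length (walks (bead_pos w a) (sites w {a<..0}))"

definition crossing_gf :: "int \<Rightarrow> int fps" where
  "crossing_gf a = ogf pair_length (crossings (bead_pos w a) 0 (sites w {a<..0}))"

lemma bead_pos_values:
  "bead_pos w 0 = - 1" "bead_pos w 1 = 1"
  "bead_pos w (- 1) = - 1 - of_bool (w ! (length w - 1) = Black)"
  "bead_pos w 2 = 2 - of_bool (w ! 2 = Black)"
proof -
  have "(- 1) mod int (length w) = int (length w - 1)"
    using long zmod_minus1[of "int (length w)"] by fastforce
  then show "bead_pos w (- 1) = - 1 - of_bool (w ! (length w - 1) = Black)"
    by (simp add: bead_pos_def)
qed (use long first second in \<open>auto simp: bead_pos_def\<close>)

lemma bead_pos_neg: "j \<le> 0 \<Longrightarrow> bead_pos w j < 0"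
  using bead_pos_bounds(2)[of w j] bead_pos_values(1) by (cases "j = 0") auto

lemma bead_pos_pos: "0 < j \<Longrightarrow> 0 < bead_pos w j"
  using bead_pos_bounds(1)[of j w] bead_pos_values(2) by (cases "j = 1") auto

text \<open>If bead \<open>- 1\<close> is black, it sits at site \<open>- 2\<close>, which leaves bead \<open>0\<close> alone at site \<open>- 1\<close>; that
  bead either belongs to the block or, if \<open>a = 0\<close>, is the starting point.\<close>

lemma narrow_passage:
  assumes "a \<le> 0"
  shows "sites w {a<..0} (0 - 1) + of_bool (bead_pos w a = 0 - 1) \<le> 1 \<or> sites w {0<..} (0 + 1) \<le> 1"
  using narrow
proof
  assume "w ! 2 = White"
  have "j = 1" if "0 < j" "bead_pos w j = 1" for j
    using that bead_pos_values(4) \<open>w ! 2 = White\<close> bead_pos_bounds(1)[of j w] by (cases "j = 2") auto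
  then have "{j \<in> {0<..}. bead_pos w j = 1} \<subseteq> {1}" by auto
  then have "sites w {0<..} 1 \<le> card {1::int}" unfolding sites_def by (rule card_mono[rotated]) simp
  then show ?thesis by simp
next
  assume last: "w ! (length w - 1) = Black"
  have only: "j = 0" if "bead_pos w j = - 1" "j \<le> 0" for j
    using that bead_pos_values(3) last bead_pos_bounds(2)[of w j] by (cases "j = - 1") auto
  then have "{j \<in> {a<..0}. bead_pos w j = - 1} \<subseteq> (if a = 0 then {} else {0})" by auto
  then have "sites w {a<..0} (- 1) \<le> card (if a = 0 then {} else {0::int})"
    unfolding sites_def by (rule card_mono[rotated]) simp
  then show ?thesis using only[of a] assms by (cases "a = 0") auto
qed

text \<open>The empty site \<open>0\<close> separates the finite block of beads \<open>a + 1, \<dots>, 0\<close> from the beads \<open>1, 2, \<dots>\<close>.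
  After the passage, the walk above sees what a walk starting at bead \<open>0\<close> would see; it is not
  empty, hence the subtraction of \<open>1\<close>.\<close>

lemma walk_gf_block_decomposition:
  assumes "a \<le> 0"
  shows "walk_gf w a = block_gf a + crossing_gf a * (walk_gf w 0 - 1)"
proof -
  let ?f1 = "sites w {a<..0}" and ?f2 = "sites w {0<..}"
  let ?X = "crossings (bead_pos w a) 0 ?f1" and ?Q = "walks (0 - 1) ?f2 - {[]}"
  let ?glue = "\<lambda>((us, vs), qs). us @ qs @ vs"
  have f1: "?f1 x = 0" if "0 \<le> x" for x
    using that bead_pos_neg by (intro sites_eq_0) force
  have f2: "?f2 x = 0" if "x \<le> 0" for x
    using that bead_pos_pos by (intro sites_eq_0) force
  note split = walks_split_at_gap[of 0 ?f1 ?f2 "bead_pos w a",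
      OF f1 f2 bead_pos_neg[OF assms] narrow_passage[OF assms]]
  have "sites w {a<..} = (\<lambda>x. ?f1 x + ?f2 x)"
  proof -
    have "{a<..} = {a<..0} \<union> {0<..}" using assms by auto
    moreover have "{a<..0} \<inter> {0<..} = {}" by auto
    ultimately show ?thesis by (simp add: fun_eq_iff sites_Un_disjoint)
  qed
  then have walks_eq: "walks (bead_pos w a) (sites w {a<..}) = walks (bead_pos w a) ?f1 \<union> ?glue ` (?X \<times> ?Q)"
    using split(1) by simp
  have finQ: "finite {ws \<in> ?Q. length ws = n}" for n
    by (rule finite_subset[OF _ finite_site_walks[of "{0<..}" 0 "0 - 1" w n]]) auto
  have finW: "finite {ws \<in> walks (bead_pos w a) (sites w J). length ws = n}" if "J \<subseteq> {a<..}" for n J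
    using that by (rule finite_site_walks)
  have "ogf length (?glue ` (?X \<times> ?Q)) = ogf (\<lambda>(x, qs). pair_length x + length qs) (?X \<times> ?Q)"
    by (rule ogf_bij_betw[symmetric, OF inj_on_imp_bij_betw[OF split(3)]]) auto
  also have "\<dots> = crossing_gf a * ogf length ?Q"
    unfolding crossing_gf_def
  proof (rule ogf_Times)
    show "finite {x \<in> ?X. pair_length x = n}" for n
      by (rule finite_subset[OF _ finite_crossings[of "{a<..0}" "bead_pos w a" 0 w]]) auto
  qed (rule finQ)
  finally have glued: "ogf length (?glue ` (?X \<times> ?Q)) = crossing_gf a * ogf length ?Q" .
  have "walk_gf w a = block_gf a + ogf length (?glue ` (?X \<times> ?Q))"
    unfolding walk_gf_def block_gf_def walks_eq
  proof (rule ogf_Un_disjoint)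
    show "finite {ws \<in> ?glue ` (?X \<times> ?Q). length ws = n}" for n
    proof (rule finite_subset[OF _ finW[OF order_refl]])
      show "{ws \<in> ?glue ` (?X \<times> ?Q). length ws = n} \<subseteq>
        {ws \<in> walks (bead_pos w a) (sites w {a<..}). length ws = n}"
        unfolding walks_eq by blast
    qed
  next
    show "finite {ws \<in> walks (bead_pos w a) ?f1. length ws = n}" for n by (rule finW) auto
  qed (rule split(2))
  moreover have "walk_gf w 0 = 1 + ogf length ?Q"
  proof -
    have "walks (bead_pos w 0) ?f2 = {[]} \<union> ?Q" by (auto simp: walks_def bead_pos_values)
    moreover have "ogf length ({[]} \<union> ?Q) = ogf length {[] :: int list} + ogf length ?Q"
    proof (rule ogf_Un_disjoint)
      show "finite {ws \<in> ?Q. length ws = n}" for n by (rule finQ)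
    qed auto
    moreover have "ogf length {[] :: int list} = 1"
    proof (rule fps_ext)
      fix n
      have "{s \<in> {[] :: int list}. length s = n} = (if n = 0 then {[]} else {})" by auto
      then show "fps_nth (ogf length {[] :: int list}) n = fps_nth 1 n" by (simp add: ogf_def)
    qed
    ultimately show ?thesis by (simp add: walk_gf_def)
  qed
  ultimately show ?thesis by (simp only: glued add_diff_cancel_left')
qed

lemma block_gf_poly: "\<exists>q. block_gf a = fps_of_poly q \<and> degree q \<le> nat (- a)"
proof (rule fps_eq_poly_of_bounded)
  fix n assume "nat (- a) < n"
  then have "{ws \<in> walks (bead_pos w a) (sites w {a<..0}). length ws = n} = {}"
    using length_le_card_sites[of "{a<..0}" _ w] by (fastforce simp: walks_def)
  then show "fps_nth (block_gf a) n = 0" 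
    by (simp only: block_gf_def ogf_def fps_nth_Abs_fps card.empty of_nat_0)
qed

lemma crossing_gf_poly: "\<exists>q. crossing_gf a = fps_of_poly q \<and> degree q \<le> nat (- a)"
proof (rule fps_eq_poly_of_bounded)
  fix n assume n: "nat (- a) < n"
  have "length us + length vs \<le> nat (- a)" if "(us, vs) \<in> crossings (bead_pos w a) 0 (sites w {a<..0})" for us vs
    using length_le_card_sites[of "{a<..0}" "us @ vs" w] that by (auto simp: crossings_def)
  with n have "{x \<in> crossings (bead_pos w a) 0 (sites w {a<..0}). pair_length x = n} = {}" by fastforce
  then show "fps_nth (crossing_gf a) n = 0" 
    by (simp only: crossing_gf_def ogf_def fps_nth_Abs_fps card.empty of_nat_0)
qed

text \<open>For \<open>a = - length w\<close>, a whole period, the series on both sides of the block decomposition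
  coincide, so \<open>walk_gf w 0 - 1 = (l - 1) / (1 - c)\<close> for the polynomials \<open>l\<close> and \<open>c\<close> of a full block. Every
  other start leaves a proper part of a period before the next bottleneck, so its two
  polynomials have degree less than \<open>length w\<close>.\<close>

lemma walk_gf_rational:
  "\<exists>den. coeff den 0 \<noteq> 0 \<and> degree den \<le> length w \<and>
    (\<forall>a. \<exists>num. walk_gf w a * fps_of_poly den = fps_of_poly num \<and> degree num \<le> 2 * length w - 1)"
proof -
  let ?p = "length w"
  let ?K = "walk_gf w 0 - 1"
  obtain l where l: "block_gf (- int ?p) = fps_of_poly l" "degree l \<le> ?p"
    using block_gf_poly[of "- int ?p"] by auto
  obtain c where c: "crossing_gf (- int ?p) = fps_of_poly c" "degree c \<le> ?p"
    using crossing_gf_poly[of "- int ?p"] by auto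
  have "bead_pos w (- int ?p) \<noteq> - 1" using bead_pos_bounds(2)[of w "- int ?p"] long by linarith
  then have "{x \<in> crossings (bead_pos w (- int ?p)) 0 (sites w {- int ?p<..0}). pair_length x = 0} = {}"
    by (auto simp: crossings_def)
  then have "fps_nth (crossing_gf (- int ?p)) 0 = 0"
    by (simp only: crossing_gf_def ogf_def fps_nth_Abs_fps card.empty of_nat_0)
  then have c0: "coeff c 0 = 0" using c(1) by simp
  have "walk_gf w (- int ?p) = walk_gf w 0"
    using walk_gf_periodic[of w "- int ?p" 1] by simp
  with walk_gf_block_decomposition[of "- int ?p"] l(1) c(1)
  have K: "?K * fps_of_poly (1 - c) = fps_of_poly (l - 1)"
    by (simp add: fps_of_poly_diff algebra_simps)
  have num: "\<exists>num. walk_gf w a * fps_of_poly (1 - c) = fps_of_poly num \<and> degree num \<le> 2 * ?p - 1" for a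
  proof -
    \<comment> \<open>The representative of \<open>a\<close> modulo the period among \<open>- (p - 1), \<dots>, 0\<close>.\<close>
    define a' where "a' = - ((- a) mod int ?p)"
    have "a = a' + (- ((- a) div int ?p)) * int ?p"
      unfolding a'_def using div_mult_mod_eq[of "- a" "int ?p"] by algebra
    then have a: "walk_gf w a = walk_gf w a'" using walk_gf_periodic by metis
    have a': "a' \<le> 0" "nat (- a') \<le> ?p - 1"
    proof -
      have "0 < int ?p" using long by linarith
      from pos_mod_bound[OF this, of "- a"] pos_mod_sign[OF this, of "- a"]
      show "a' \<le> 0" "nat (- a') \<le> ?p - 1" unfolding a'_def by linarith+
    qed
    obtain l' where l': "block_gf a' = fps_of_poly l'" "degree l' \<le> ?p - 1"
      using block_gf_poly[of a'] a'(2) by (metis order_trans)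
    obtain c' where c': "crossing_gf a' = fps_of_poly c'" "degree c' \<le> ?p - 1"
      using crossing_gf_poly[of a'] a'(2) by (metis order_trans)
    let ?num = "l' * (1 - c) + c' * (l - 1)"
    have "walk_gf w a * fps_of_poly (1 - c) =
        fps_of_poly l' * fps_of_poly (1 - c) + fps_of_poly c' * (?K * fps_of_poly (1 - c))"
      unfolding a walk_gf_block_decomposition[OF a'(1)] l'(1) c'(1) by (simp add: algebra_simps)
    also have "\<dots> = fps_of_poly ?num"
      unfolding K by (simp add: fps_of_poly_add fps_of_poly_mult)
    finally have "walk_gf w a * fps_of_poly (1 - c) = fps_of_poly ?num" .
    moreover have "degree (1 - c) \<le> ?p" "degree (l - 1) \<le> ?p"
      using c(2) l(2) by (auto intro: degree_diff_le)
    then have "degree ?num \<le> (?p - 1) + ?p"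
      using l'(2) c'(2)
      by (intro degree_add_le order_trans[OF degree_mult_le] add_mono) auto
    ultimately show ?thesis using long by (intro exI[of _ ?num]) auto
  qed
  show ?thesis
    by (rule exI[of _ "1 - c"]) (use c0 c(2) num in \<open>auto intro: degree_diff_le\<close>)
qed

end

section \<open>Stabilisation of the level counts\<close>

text \<open>The two site functions differ in a shift by \<open>m - 1\<close> and in the beads beyond the \<open>m\<close>-th, which are
  out of reach for \<open>i\<close> moves. The starting bead \<open>- 1\<close> is, by periodicity, the last bead of the word.\<close>

lemma card_backward_plays_cyclic:
  fixes u :: "bead list" and i k n :: nat
  defines "s \<equiv> bits (concat (replicate k u))"
  assumes u: "u \<noteq> []" and k: "2 * i + 3 \<le> k" and n: "cyclic_partition s \<in> partitions n"
  shows "int (card {ys \<in> partitions n. (bulgarian ^^ i) ys = cyclic_partition s}) =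
    fps_nth (walk_gf u (- 1)) i"
proof -
  define m where "m = length s"
  have m_eq: "m = k * length u" by (simp add: m_def s_def)
  have m: "2 * i + 3 \<le> m" using k u unfolding m_eq by (cases u) (auto intro: order_trans)
  have s: "set s \<subseteq> {0, 1}" unfolding s_def by (rule set_bits)
  have nth_s: "s ! t = of_bool (u ! (t mod length u) = Black)" if "t < m" for t
    using that by (simp add: s_def m_eq nth_bits nth_concat_replicate)
  have s_pos: "int t - int (s ! t) = bead_pos u (int t)" if "t < m" for t
    using nth_s[OF that] by (simp add: bead_pos_def nat_mod_distrib flip: zmod_int)
  have "s \<noteq> []" using m by (auto simp: m_def)
  then have s_snoc: "s = butlast s @ [last s]" by simp
  have len: "length (cyclic_partition s) = m - 1 + s ! (m - 1)"
    using length_cyclic_partition[of "butlast s" "last s"] s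
    unfolding s_snoc[symmetric] by (simp add: m_def last_conv_nth[OF \<open>s \<noteq> []\<close>])
  have "bead_pos u (- 1) = bead_pos u (int (m - 1)) - int m"
  proof -
    have "int (m - 1) = - 1 + int m" using m by linarith
    also have "int m = int k * int (length u)" by (simp add: m_eq)
    finally have "int (m - 1) mod int (length u) = (- 1) mod int (length u)"
      by (simp only: mod_mult_self1)
    then show ?thesis using m by (simp add: bead_pos_def of_nat_diff)
  qed
  then have start: "- int (length (cyclic_partition s)) - 1 = bead_pos u (- 1) + (- (int m - 1))"
    using s_pos[of "m - 1"] m by (simp add: len of_nat_diff)
  have "int (card {ys \<in> partitions n. (bulgarian ^^ i) ys = cyclic_partition s}) =
    int (card {ws \<in> walks (bead_pos u (- 1) + (- (int m - 1))) (part_sites (cyclic_partition s)). length ws = i})"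
    unfolding start[symmetric] using card_backward_plays[OF n, of i] m by (simp add: len)
  also have "\<dots> = int (card {ws \<in> walks (bead_pos u (- 1))
      (\<lambda>x. part_sites (cyclic_partition s) (x + (- (int m - 1)))). length ws = i})"
    by (simp only: card_walks_shift)
  also have "{ws \<in> walks (bead_pos u (- 1))
      (\<lambda>x. part_sites (cyclic_partition s) (x + (- (int m - 1)))). length ws = i} =
    {ws \<in> walks (bead_pos u (- 1)) (sites u {- 1<..}). length ws = i}"
  proof (rule walks_cong)
    fix x assume "x \<le> bead_pos u (- 1) + 2 * int i"
    then have x: "x + 1 < int m" "x + 1 \<le> 2 * int i" using bead_pos_bounds(2)[of u "- 1"] m by auto
    let ?v = "nat (int m - 1 - x)"
    have v: "0 < ?v" "int ?v = int m - 1 - x" using x m by auto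
    have "part_sites (cyclic_partition s) (x + (- (int m - 1))) = count_list (cyclic_partition s) ?v"
      using x by (simp add: part_sites_def algebra_simps)
    also have "\<dots> = length (filter ((=) ?v) (staircase_plus s))"
      using v(1) by (simp add: count_list_eq_length_filter cyclic_partition_def)
        (rule arg_cong[where f = length], rule filter_cong, auto)
    also have "\<dots> = card {t. t < m \<and> ?v = staircase_plus s ! t}"
      by (simp add: length_filter_conv_card m_def)
    also have "{t. t < m \<and> ?v = staircase_plus s ! t} = {t. t < m \<and> bead_pos u (int t) = x}"
    proof (intro Collect_cong conj_cong refl)
      fix t assume t: "t < m"
      have "?v = staircase_plus s ! t \<longleftrightarrow> int ?v = int (staircase_plus s ! t)" by (rule of_nat_eq_iff[symmetric])
      then show "?v = staircase_plus s ! t \<longleftrightarrow> bead_pos u (int t) = x"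
        using t v(2) s_pos[OF t, symmetric] by (auto simp: nth_staircase_plus m_def of_nat_diff)
    qed
    also have "card \<dots> = sites u {- 1<..} x"
      unfolding sites_def
    proof (rule bij_betw_same_card[of int], rule bij_betw_byWitness[where f' = nat])
      show "nat ` {j \<in> {- 1<..}. bead_pos u j = x} \<subseteq> {t. t < m \<and> bead_pos u (int t) = x}"
      proof
        fix t assume "t \<in> nat ` {j \<in> {- 1<..}. bead_pos u j = x}"
        then obtain j where j: "t = nat j" "0 \<le> j" "bead_pos u j = x" by auto
        with x(1) bead_pos_bounds(1)[of j u] show "t \<in> {t. t < m \<and> bead_pos u (int t) = x}"
          by (simp add: nat_less_iff)
      qed
    qed auto
    finally show "part_sites (cyclic_partition s) (x + (- (int m - 1))) = sites u {- 1<..} x" .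
  qed
  finally show ?thesis by (simp add: walk_gf_def ogf_def)
qed

text \<open>Partitions of level at most \<open>i\<close> correspond to walks of length exactly \<open>i\<close> from the members of the
  cycle, which are indexed by the distinct rotations of the period. The factor \<open>1 - x\<close> takes
  differences of consecutive counts.\<close>

lemma coeff_level_poly_power:
  assumes v: "v \<noteq> []" and k: "2 * i + 3 \<le> k"
  shows "coeff (level_poly (necklace_power (necklace_of v) k)) i =
    fps_nth ((1 - fps_X) * (\<Sum>u\<in>range (\<lambda>r. rotate r v). walk_gf u (- 1))) i"
proof -
  define V where "V = concat (replicate k v)"
  let ?R = "range (\<lambda>r. rotate r v)"
  let ?G = "\<Sum>u\<in>?R. walk_gf u (- 1)"
  have V: "V \<noteq> []" using v k by (cases k) (auto simp: V_def)
  have range_V: "range (\<lambda>r. rotate r V) = (\<lambda>u. concat (replicate k u)) ` ?R"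
    by (auto simp: V_def rotate_concat_replicate)
  have inj: "inj_on (\<lambda>u. concat (replicate k u)) ?R"
  proof (rule inj_onI)
    fix x y assume xy: "x \<in> ?R" "y \<in> ?R" "concat (replicate k x) = concat (replicate k y)"
    then have len: "length x = length y" by auto
    obtain k' where "k = Suc k'" using k by (cases k) auto
    with xy(3) len show "x = y" by simp
  qed
  have reach: "int (card (reaching (necklace_of V) j)) = fps_nth ?G j" if "j \<le> i" for j
  proof -
    let ?n = "orbit_weight (necklace_of V)"
    have "int (card (reaching (necklace_of V) j)) = (\<Sum>u\<in>?R. int (card {ys \<in> partitions ?n.
        (bulgarian ^^ j) ys = cyclic_partition (bits (concat (replicate k u)))}))"
      unfolding card_reaching[OF V] range_V by (simp add: sum.reindex[OF inj])
    also have "\<dots> = (\<Sum>u\<in>?R. fps_nth (walk_gf u (- 1)) j)"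
    proof (rule sum.cong[OF refl], rule card_backward_plays_cyclic)
      fix u assume u: "u \<in> ?R"
      then show "u \<noteq> []" using v by auto
      show "2 * j + 3 \<le> k" using k that by simp
      have "cyclic_partition (bits (concat (replicate k u))) \<in> recurrent_cycle (necklace_of V)"
        unfolding recurrent_cycle_of[OF V] range_V using u by blast
      then show "cyclic_partition (bits (concat (replicate k u))) \<in> partitions ?n"
        by (simp add: recurrent_cycle_def)
    qed
    finally show ?thesis by (simp add: fps_sum_nth)
  qed
  have "coeff (level_poly (necklace_of V)) i =
      int (card (reaching (necklace_of V) i)) -
      (if i = 0 then 0 else int (card (reaching (necklace_of V) (i - 1))))"
    by (rule coeff_level_poly) (rule bulgarian_recurrent_cycle[OF V])
  also have "\<dots> = fps_nth ((1 - fps_X) * ?G) i"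
    using reach[of i] reach[of "i - 1"] by (simp add: left_diff_distrib)
  finally show ?thesis by (simp add: necklace_power_of V_def)
qed

theorem theorem1p2:
  fixes P :: necklace
  assumes "primitive P" and "necklace_length P \<ge> 3"
  shows "\<exists>H :: int fps.
    (\<forall>i. (\<lambda>k. coeff (level_poly (necklace_power P k)) i) \<longlonglongrightarrow> fps_nth H i) \<and>
    (\<exists>num den :: int poly.
       coeff den 0 \<noteq> 0 \<and>
       H * fps_of_poly den = fps_of_poly num \<and>
       degree den \<le> necklace_length P \<and>
       degree num \<le> 2 * necklace_length P)"
proof -
  have "\<exists>v. P = necklace_of v"
    by transfer (metis rotation_equiv_def rotate0 id_apply)
  then obtain v where v: "P = necklace_of v" ..
  have len: "3 \<le> length v" using assms(2) by (simp add: v)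
  obtain g where g: "rotate g v ! 0 = Black" "rotate g v ! 1 = White"
    "rotate g v ! (length v - 1) = Black \<or> rotate g v ! 2 = White"
    using primitive_has_bottleneck[of v] assms(1) len unfolding v by blast
  define w where "w = rotate g v"
  have w: "P = necklace_of w" "length w = length v"
    using necklace_of_eq_iff[of w v] by (auto simp: v w_def)
  interpret bottleneck w
    by unfold_locales (use g len in \<open>auto simp: w_def\<close>)
  have ne: "w \<noteq> []" using long by auto
  let ?R = "range (\<lambda>r. rotate r w)"
  let ?H = "(1 - fps_X) * (\<Sum>u\<in>?R. walk_gf u (- 1))"
  obtain den where den: "coeff den 0 \<noteq> 0" "degree den \<le> length w"
    and num: "\<And>a. \<exists>num. walk_gf w a * fps_of_poly den = fps_of_poly num \<and> degree num \<le> 2 * length w - 1"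
    using walk_gf_rational by blast
  have "\<exists>num. walk_gf u (- 1) * fps_of_poly den = fps_of_poly num \<and> degree num \<le> 2 * length w - 1"
    if "u \<in> ?R" for u
    using that num walk_gf_rotate[OF ne] by auto
  then obtain q where q: "\<And>u. u \<in> ?R \<Longrightarrow> walk_gf u (- 1) * fps_of_poly den = fps_of_poly (q u)"
    "\<And>u. u \<in> ?R \<Longrightarrow> degree (q u) \<le> 2 * length w - 1"
    by metis
  \<comment> \<open>The factor \<open>1 - x\<close> raises the degree bound \<open>2 * length w - 1\<close> of the single series by one.\<close>
  let ?num = "[:1, - 1:] * (\<Sum>u\<in>?R. q u)"
  have "?H * fps_of_poly den = fps_of_poly ?num"
  proof -
    have "fps_of_poly [:1, - 1 :: int:] = 1 - fps_X" by (simp add: fps_of_poly_pCons)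
    moreover have "(\<Sum>u\<in>?R. walk_gf u (- 1)) * fps_of_poly den = fps_of_poly (\<Sum>u\<in>?R. q u)"
      by (simp add: sum_distrib_right fps_of_poly_sum q(1) cong: sum.cong)
    ultimately show ?thesis by (simp only: fps_of_poly_mult mult.assoc)
  qed
  moreover have "degree ?num \<le> 2 * length w"
  proof -
    have "finite ?R"
      by (rule finite_subset[OF _ finite_lists_length_eq[of "set w" "length w"]]) auto
    then have "degree (\<Sum>u\<in>?R. q u) \<le> 2 * length w - 1"
      by (rule degree_sum_le) (rule q(2))
    then have "degree ?num \<le> 1 + (2 * length w - 1)"
      by (intro order_trans[OF degree_mult_le] add_mono) auto
    then show ?thesis using long by simp
  qed
  moreover have "(\<lambda>k. coeff (level_poly (necklace_power P k)) i) \<longlonglongrightarrow> fps_nth ?H i" for i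
  proof (rule tendsto_eventually)
    show "\<forall>\<^sub>F k in sequentially. coeff (level_poly (necklace_power P k)) i = fps_nth ?H i"
      using eventually_ge_at_top[of "2 * i + 3"]
      by eventually_elim (simp only: w(1) coeff_level_poly_power[OF ne])
  qed
  moreover have "necklace_length P = length w" by (simp add: w(1))
  ultimately show ?thesis using den by (intro exI[of _ ?H] exI[of _ ?num] exI[of _ den] conjI allI) auto
qed

end
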